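(* Let $\lambda\in\mathbb{C}^*$, $\beta(y)\in\mathbb{C}[y]$, and let $\Psi_{\mathfrak{fv}}(\lambda,\beta)=\mathbb{C}[x,y]\oplus\mathbb{C}[s,t]$ be the associated module over the Fermion-Virasoro algebra $\mathfrak{fv}$. (1) For $\alpha\in\mathbb{C}$, $\Psi_{\mathfrak{fv}}(\lambda,\beta)$ has the following submodule filtration: $$\cdots\subseteq(y-\alpha)^n\mathbb{C}[x,y]\oplus(t-\alpha)^n\mathbb{C}[s,t]\subseteq(y-\alpha)^{n-1}\mathbb{C}[x,y]\oplus(t-\alpha)^{n-1}\mathbb{C}[s,t]\subseteq\cdots\subseteq\mathbb{C}[x,y]\oplus\mathbb{C}[s,t].$$ (2) Let $b\in\mathbb{C}$ and $g(y),g'(y)\in\mathbb{C}[y]$ with $g(y)=(y-b)g'(y)$, and let $M_g^{\mathfrak{fv}}=g(y)\mathbb{C}[x,y]\oplus g(t)\mathbb{C}[s,t]\subseteq\Psi_{\mathfrak{fv}}(\lambda,\beta)$ (and likewise $M_{g'}^{\mathfrak{fv}}$). Then, as $\mathfrak{fv}$-modules, $M_{g'}^{\mathfrak{fv}}/M_g^{\mathfrak{fv}}\cong\Phi_{\mathfrak{fv}}(\lambda,\beta,b)$.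
   Context: All vector spaces are over $\mathbb{C}$; all modules over Lie superalgebras are $\mathbb{Z}_2$-graded; $\mathbb{C}^*$ is the set of nonzero complex numbers. The Fermion-Virasoro algebra $\mathfrak{fv}$ is the Lie superalgebra with even basis elements $L_m$ ($m\in\mathbb{Z}$), $C_1,C_3$ and odd basis elements $Q_p$ ($p\in\mathbb{Z}+\frac12$), and brackets $[L_m,L_n]=(m-n)L_{m+n}+\delta_{m+n,0}\frac{m^3-m}{12}C_1$, $[L_m,Q_p]=-(\frac m2+p)Q_{m+p}$, $[Q_p,Q_q]=\delta_{p+q,0}C_3$, with $C_1,C_3$ central. $\Psi_{\mathfrak{fv}}(\lambda,\beta)$ is the $\mathfrak{fv}$-module with even part $\mathbb{C}[x,y]$, odd part $\mathbb{C}[s,t]$ and actions (for a two-variable polynomial $f$, $m\in\mathbb{Z}$, $p\in\mathbb{Z}+\frac12$): $L_mf(x,y)=\lambda^m(x+m\beta(y))f(x+m,y)$, $L_mf(s,t)=\lambda^m(s+m(\beta(t)+\frac12))f(s+m,t)$, $Q_pf(x,y)=0$, $Q_pf(s,t)=\lambda^{p+\frac12}yf(x+p,y)$, and $C_1,C_3$ act as $0$. $\Phi_{\mathfrak{fv}}(\lambda,\beta,b)$ is the $\mathfrak{fv}$-module with even part $\mathbb{C}[x]$, odd part $\mathbb{C}[s]$ and nontrivial actions (for a one-variable polynomial $f$): $L_mf(x)=\lambda^m(x+m\beta(b))f(x+m)$, $L_mf(s)=\lambda^m(s+m(\beta(b)+\frac12))f(s+m)$, $Q_pf(s)=\lambda^{p+\frac12}bf(x+p)$;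 the actions of $Q_p$ on $\mathbb{C}[x]$ and of $C_1,C_3$ are zero.
   Formalization: In part (2) the polynomial g (equivalently g') is assumed nonzero; for g = g' = 0 the quotient is zero while Φ is not, so the claim as worded fails there. *)

theory Defs
  imports
    "HOL-Library.Poly_Mapping"
    "HOL-Library.Product_Plus"
    "HOL-Library.Z2"
    "HOL-Computational_Algebra.Polynomial"
    "HOL-Algebra.Module"
    "HOL-Algebra.AbelCoset"
    "HOL-Algebra.Algebraic_Closure_Type"
begin

section \<open>Lie superalgebras over the complex numbers and their modules\<close>

abbreviation complex_ring :: "complex ring"
  where "complex_ring \<equiv> ring_of_type_algebra"

record 'a super_space = "(complex, 'a) module" +
  grade :: "bit \<Rightarrow> 'a set"

locale super_vector_space = module complex_ring V
  for V :: "('a, 'x) super_space_scheme" (structure) +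
  assumes grade_submodule: "submodule (grade V a) complex_ring V"
    and grade_sum: "grade V 0 <+>\<^bsub>V\<^esub> grade V 1 = carrier V"
    and grade_int: "grade V 0 \<inter> grade V 1 = {\<zero>\<^bsub>V\<^esub>}"

definition super_sign :: "bit \<Rightarrow> bit \<Rightarrow> complex"
  where "super_sign a b = (if a = 1 \<and> b = 1 then - 1 else 1)"

definition bilinear_map ::
  "('a, 'x) super_space_scheme \<Rightarrow> ('b, 'y) super_space_scheme \<Rightarrow>
   ('c, 'z) super_space_scheme \<Rightarrow> ('a \<Rightarrow> 'b \<Rightarrow> 'c) \<Rightarrow> bool"
  where "bilinear_map U V W f \<longleftrightarrow>
    (\<forall>x\<in>carrier U. \<forall>y\<in>carrier V. f x y \<in> carrier W) \<and>
    (\<forall>x\<in>carrier U. \<forall>x'\<in>carrier U. \<forall>y\<in>carrier V. f (x \<oplus>\<^bsub>U\<^esub> x') y = f x y \<oplus>\<^bsub>W\<^esub> f x' y) \<and>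
    (\<forall>x\<in>carrier U. \<forall>y\<in>carrier V. \<forall>y'\<in>carrier V. f x (y \<oplus>\<^bsub>V\<^esub> y') = f x y \<oplus>\<^bsub>W\<^esub> f x y') \<and>
    (\<forall>c. \<forall>x\<in>carrier U. \<forall>y\<in>carrier V. f (c \<odot>\<^bsub>U\<^esub> x) y = c \<odot>\<^bsub>W\<^esub> f x y) \<and>
    (\<forall>c. \<forall>x\<in>carrier U. \<forall>y\<in>carrier V. f x (c \<odot>\<^bsub>V\<^esub> y) = c \<odot>\<^bsub>W\<^esub> f x y)"

record 'a lie_superalg = "'a super_space" +
  bracket :: "'a \<Rightarrow> 'a \<Rightarrow> 'a"

locale lie_superalgebra = super_vector_space G
  for G :: "('a, 'x) lie_superalg_scheme" (structure) +
  assumes bracket_bilinear: "bilinear_map G G G (bracket G)"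
    and bracket_grade:
      "\<lbrakk>x \<in> grade G a; y \<in> grade G b\<rbrakk> \<Longrightarrow> bracket G x y \<in> grade G (a + b)"
    and bracket_skew:
      "\<lbrakk>x \<in> grade G a; y \<in> grade G b\<rbrakk> \<Longrightarrow>
       bracket G x y = (- super_sign a b) \<odot>\<^bsub>G\<^esub> bracket G y x"
    and bracket_jacobi:
      "\<lbrakk>x \<in> grade G a; y \<in> grade G b; z \<in> grade G c\<rbrakk> \<Longrightarrow>
       bracket G x (bracket G y z) =
         bracket G (bracket G x y) z \<oplus>\<^bsub>G\<^esub> super_sign a b \<odot>\<^bsub>G\<^esub> bracket G y (bracket G x z)"

record ('g, 'a) lie_supermod = "'a super_space" +
  action :: "'g \<Rightarrow> 'a \<Rightarrow> 'a"

locale lie_supermodule = lie_superalgebra G + V?: super_vector_space V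
  for G :: "('g, 'x) lie_superalg_scheme" and V :: "('g, 'a, 'y) lie_supermod_scheme" (structure) +
  assumes action_bilinear: "bilinear_map G V V (action V)"
    and action_grade:
      "\<lbrakk>x \<in> grade G a; v \<in> grade V b\<rbrakk> \<Longrightarrow> action V x v \<in> grade V (a + b)"
    and action_bracket:
      "\<lbrakk>x \<in> grade G a; y \<in> grade G b; v \<in> carrier V\<rbrakk> \<Longrightarrow>
       action V (bracket G x y) v =
         action V x (action V y v) \<ominus>\<^bsub>V\<^esub> super_sign a b \<odot>\<^bsub>V\<^esub> action V y (action V x v)"

locale lie_subsupermodule = lie_supermodule G V + submodule N complex_ring V
  for N and G :: "('g, 'x) lie_superalg_scheme" and V :: "('g, 'a, 'y) lie_supermod_scheme" (structure) +
  assumes sub_graded: "N = (N \<inter> grade V 0) <+>\<^bsub>V\<^esub> (N \<inter> grade V 1)"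
    and sub_action: "\<lbrakk>x \<in> carrier G; v \<in> N\<rbrakk> \<Longrightarrow> action V x v \<in> N"

text \<open>A submodule regarded as a module in its own right.\<close>

definition restrict_supermod ::
  "('g, 'a) lie_supermod \<Rightarrow> 'a set \<Rightarrow> ('g, 'a) lie_supermod"
  where "restrict_supermod V N = V\<lparr>carrier := N, grade := (\<lambda>a. N \<inter> grade V a)\<rparr>"

text \<open>
  The quotient \<open>V/N\<close> has the cosets of \<open>N\<close> as elements. The unions over all representatives
  collapse to a single coset when \<open>N\<close> is a submodule. The multiplicative fields inherited from
  the ring record are irrelevant for modules and left unspecified, here and below.
\<close>

definition quotient_supermod ::
  "('g, 'a) lie_supermod \<Rightarrow> 'a set \<Rightarrow> ('g, 'a set) lie_supermod"
  where "quotient_supermod V N =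
    \<lparr>carrier = a_rcosets\<^bsub>V\<^esub> N, monoid.mult = undefined, one = undefined,
     ring.zero = N, add = set_add V,
     module.smult = (\<lambda>c A. \<Union>x\<in>A. N +>\<^bsub>V\<^esub> (c \<odot>\<^bsub>V\<^esub> x)),
     grade = (\<lambda>a. (\<lambda>v. N +>\<^bsub>V\<^esub> v) ` grade V a),
     action = (\<lambda>g A. \<Union>x\<in>A. N +>\<^bsub>V\<^esub> action V g x)\<rparr>"

text \<open>Homomorphisms are required to preserve the \<open>\<int>\<^sub>2\<close>-grading (no parity shift).\<close>

definition supermod_hom ::
  "('g, 'x) lie_superalg_scheme \<Rightarrow> ('g, 'a, 'y) lie_supermod_scheme \<Rightarrow>
   ('g, 'b, 'z) lie_supermod_scheme \<Rightarrow> ('a \<Rightarrow> 'b) set"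
  where "supermod_hom G V W =
    {h \<in> carrier V \<rightarrow> carrier W.
      (\<forall>v\<in>carrier V. \<forall>w\<in>carrier V. h (v \<oplus>\<^bsub>V\<^esub> w) = h v \<oplus>\<^bsub>W\<^esub> h w) \<and>
      (\<forall>c. \<forall>v\<in>carrier V. h (c \<odot>\<^bsub>V\<^esub> v) = c \<odot>\<^bsub>W\<^esub> h v) \<and>
      (\<forall>a. \<forall>v\<in>grade V a. h v \<in> grade W a) \<and>
      (\<forall>x\<in>carrier G. \<forall>v\<in>carrier V. h (action V x v) = action W x (h v))}"

definition supermod_isomorphic ::
  "('g, 'x) lie_superalg_scheme \<Rightarrow> ('g, 'a, 'y) lie_supermod_scheme \<Rightarrow>
   ('g, 'b, 'z) lie_supermod_scheme \<Rightarrow> bool"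
  where "supermod_isomorphic G V W \<longleftrightarrow>
    lie_supermodule G V \<and> lie_supermodule G W \<and>
    (\<exists>h\<in>supermod_hom G V W. bij_betw h (carrier V) (carrier W))"


section \<open>The Fermion-Virasoro algebra\<close>

text \<open>
  The half-integers \<open>p \<in> \<int> + 1/2\<close> are parametrised by integers \<open>k\<close> via \<open>p = k + 1/2\<close>: the basis
  element \<open>Q k\<close> below is the one written \<open>Q\<^sub>p\<close> with \<open>p = half k\<close>. In particular
  \<open>p + 1/2 = k + 1\<close>, and \<open>Q\<^bsub>m+p\<^esub>\<close> is \<open>Q (m + k)\<close>.
\<close>

datatype fv_basis = L int | Q int | C1 | C3

definition half :: "int \<Rightarrow> complex"
  where "half k = of_int k + 1 / 2"

type_synonym fv = "fv_basis \<Rightarrow>\<^sub>0 complex"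

fun fv_parity :: "fv_basis \<Rightarrow> bit"
  where "fv_parity (Q k) = 1" | "fv_parity _ = 0"

fun fv_basis_bracket :: "fv_basis \<Rightarrow> fv_basis \<Rightarrow> fv" where
  "fv_basis_bracket (L m) (L n) =
     Poly_Mapping.single (L (m + n)) (of_int (m - n)) +
     (if m + n = 0 then Poly_Mapping.single C1 (of_int (m ^ 3 - m) / 12) else 0)"
| "fv_basis_bracket (L m) (Q k) =
     Poly_Mapping.single (Q (m + k)) (- (of_int m / 2 + half k))"
| "fv_basis_bracket (Q k) (L m) =
     Poly_Mapping.single (Q (m + k)) (of_int m / 2 + half k)"
| "fv_basis_bracket (Q k) (Q l) =
     (if half k + half l = 0 then Poly_Mapping.single C3 1 else 0)"
| "fv_basis_bracket _ _ = 0"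

definition fv_scale :: "complex \<Rightarrow> fv \<Rightarrow> fv"
  where "fv_scale c u = Poly_Mapping.map ((*) c) u"

definition fv_bracket :: "fv \<Rightarrow> fv \<Rightarrow> fv"
  where "fv_bracket u v =
    (\<Sum>i\<in>Poly_Mapping.keys u. \<Sum>j\<in>Poly_Mapping.keys v.
      fv_scale (Poly_Mapping.lookup u i * Poly_Mapping.lookup v j) (fv_basis_bracket i j))"

definition fv_algebra :: "fv lie_superalg"
  where "fv_algebra =
    \<lparr>carrier = UNIV, monoid.mult = undefined, one = undefined,
     ring.zero = 0, add = (+), module.smult = fv_scale,
     grade = (\<lambda>a. {u. \<forall>i\<in>Poly_Mapping.keys u. fv_parity i = a}),
     bracket = fv_bracket\<rparr>"


section \<open>The modules \<open>\<Psi>\<close> and \<open>\<Phi>\<close>\<close>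

definition fv_linear_extension ::
  "(complex \<Rightarrow> 'a \<Rightarrow> 'a) \<Rightarrow> (fv_basis \<Rightarrow> 'a \<Rightarrow> 'a) \<Rightarrow> fv \<Rightarrow> 'a \<Rightarrow> 'a::comm_monoid_add"
  where "fv_linear_extension sc A u v =
    (\<Sum>i\<in>Poly_Mapping.keys u. sc (Poly_Mapping.lookup u i) (A i v))"

text \<open>
  \<open>\<complex>[x,y]\<close> is represented as \<open>\<complex>[y][x]\<close>, i.e. as polynomials in the outer variable \<open>x\<close> whose
  coefficients are polynomials in the inner variable \<open>y\<close>; \<open>\<complex>[s,t]\<close> likewise with outer variable
  \<open>s\<close> and inner variable \<open>t\<close>. A pair \<open>(f, h)\<close> stands for \<open>f(x,y) + h(s,t)\<close>.
\<close>

type_synonym poly2 = "complex poly poly"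

definition outer_var :: poly2
  where "outer_var = [:0, 1:]"

definition inner_poly :: "complex poly \<Rightarrow> poly2"
  where "inner_poly g = [:g:]"

definition const2 :: "complex \<Rightarrow> poly2"
  where "const2 c = [:[:c:]:]"

definition shift2 :: "complex \<Rightarrow> poly2 \<Rightarrow> poly2"
  where "shift2 c f = pcompose f (outer_var + const2 c)"

definition Psi_scale :: "complex \<Rightarrow> poly2 \<times> poly2 \<Rightarrow> poly2 \<times> poly2"
  where "Psi_scale c v = (const2 c * fst v, const2 c * snd v)"

fun Psi_basis_action ::
  "complex \<Rightarrow> complex poly \<Rightarrow> fv_basis \<Rightarrow> poly2 \<times> poly2 \<Rightarrow> poly2 \<times> poly2" where
  "Psi_basis_action lam \<beta> (L m) (f, h) =
     (const2 (lam powi m) * (outer_var + of_int m * inner_poly \<beta>) * shift2 (of_int m) f,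
      const2 (lam powi m) * (outer_var + of_int m * (inner_poly \<beta> + const2 (1 / 2))) *
        shift2 (of_int m) h)"
| "Psi_basis_action lam \<beta> (Q k) (f, h) =
     (const2 (lam powi (k + 1)) * inner_poly [:0, 1:] * shift2 (half k) h, 0)"
| "Psi_basis_action lam \<beta> C1 (f, h) = 0"
| "Psi_basis_action lam \<beta> C3 (f, h) = 0"

definition Psi :: "complex \<Rightarrow> complex poly \<Rightarrow> (fv, poly2 \<times> poly2) lie_supermod"
  where "Psi lam \<beta> =
    \<lparr>carrier = UNIV, monoid.mult = undefined, one = undefined,
     ring.zero = 0, add = (+), module.smult = Psi_scale,
     grade = (\<lambda>a. if a = 0 then {(f, 0) | f. True} else {(0, h) | h. True}),
     action = fv_linear_extension Psi_scale (Psi_basis_action lam \<beta>)\<rparr>"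

definition shift1 :: "complex \<Rightarrow> complex poly \<Rightarrow> complex poly"
  where "shift1 c f = pcompose f [:c, 1:]"

definition Phi_scale :: "complex \<Rightarrow> complex poly \<times> complex poly \<Rightarrow> complex poly \<times> complex poly"
  where "Phi_scale c v = (Polynomial.smult c (fst v), Polynomial.smult c (snd v))"

fun Phi_basis_action ::
  "complex \<Rightarrow> complex poly \<Rightarrow> complex \<Rightarrow> fv_basis \<Rightarrow>
   complex poly \<times> complex poly \<Rightarrow> complex poly \<times> complex poly" where
  "Phi_basis_action lam \<beta> b (L m) (f, h) =
     (Polynomial.smult (lam powi m) ([:of_int m * poly \<beta> b, 1:] * shift1 (of_int m) f),
      Polynomial.smult (lam powi m) ([:of_int m * (poly \<beta> b + 1 / 2), 1:] * shift1 (of_int m) h))"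
| "Phi_basis_action lam \<beta> b (Q k) (f, h) =
     (Polynomial.smult (lam powi (k + 1) * b) (shift1 (half k) h), 0)"
| "Phi_basis_action lam \<beta> b C1 (f, h) = 0"
| "Phi_basis_action lam \<beta> b C3 (f, h) = 0"

definition Phi ::
  "complex \<Rightarrow> complex poly \<Rightarrow> complex \<Rightarrow> (fv, complex poly \<times> complex poly) lie_supermod"
  where "Phi lam \<beta> b =
    \<lparr>carrier = UNIV, monoid.mult = undefined, one = undefined,
     ring.zero = 0, add = (+), module.smult = Phi_scale,
     grade = (\<lambda>a. if a = 0 then {(f, 0) | f. True} else {(0, h) | h. True}),
     action = fv_linear_extension Phi_scale (Phi_basis_action lam \<beta> b)\<rparr>"

text \<open>The subspace \<open>g(y) \<complex>[x,y] \<oplus> g(t) \<complex>[s,t]\<close> of \<open>\<Psi>\<close>.\<close>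

definition M_fv :: "complex poly \<Rightarrow> (poly2 \<times> poly2) set"
  where "M_fv g = {(inner_poly g * f, inner_poly g * h) | f h. True}"

end

theory Submission
  imports Defs
begin

text \<open>
  Every operator of \<open>\<Psi>\<close> shifts the outer variable and multiplies by a polynomial, while the inner
  variable enters only as a scalar. Hence \<open>\<Psi>\<close> is in effect a module over polynomials in the inner
  variable, and two kinds of maps commute with the action: multiplication by an inner polynomial
  \<open>g\<close> (\<open>inner_mult_action\<close>) and specialisation of the inner variable to a number \<open>b\<close>
  (\<open>ev_pair_action\<close>), the latter with values in \<open>\<Phi>\<close>.

  The first kind shows that the image \<open>M_fv g\<close> of multiplication by \<open>g\<close> is a graded submodule
  (\<open>lie_subsupermodule_M_fv\<close>), which decreases when \<open>g\<close> gets further factors; powers of \<open>y - \<alpha>\<close> give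
  the filtration. For the quotients, divide by \<open>g'\<close> and then put \<open>y = b\<close>. This is a homomorphism
  from \<open>M_fv g'\<close> onto \<open>\<Phi>\<close>, and by the factor theorem applied to the coefficients of the powers of
  the outer variable (\<open>ev_eq_0_iff\<close>) its kernel is the multiples of \<open>(y - b) g'\<close>. The
  isomorphism theorem \<open>quotient_supermod_kernel_isomorphic\<close> concludes.

  Underneath lie the facts that \<open>fv\<close> is a Lie superalgebra (\<open>lie_superalgebra_fv\<close>) and \<open>\<Psi>\<close> a
  supermodule over it (\<open>lie_supermodule_Psi\<close>). Both amount to multilinear identities, which are
  checked on basis elements. That \<open>\<Phi>\<close> is a supermodule follows from specialisation being onto,
  since the axioms pass to homomorphic images whose homogeneous parts meet trivially
  (\<open>lie_supermodule_image\<close>).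
\<close>

section \<open>Supermodules, their images and quotients\<close>

lemma complex_ring_simps [simp]:
  "carrier complex_ring = UNIV" "\<zero>\<^bsub>complex_ring\<^esub> = 0" "\<one>\<^bsub>complex_ring\<^esub> = 1"
  "add complex_ring = (+)" "monoid.mult complex_ring = (*)"
  by (simp_all add: ring_of_type_algebra_def)

lemma complex_ring_uminus [simp]: "\<ominus>\<^bsub>complex_ring\<^esub> c = - c"
proof -
  interpret R: cring complex_ring by (rule cring_from_type_algebra)
  show ?thesis by (rule R.minus_equality) simp_all
qed

lemma complex_module_uminus:
  assumes "module complex_ring V" "v \<in> carrier V"
  shows "\<ominus>\<^bsub>V\<^esub> v = (- 1) \<odot>\<^bsub>V\<^esub> v"
proof -
  interpret module complex_ring V by fact
  show ?thesis using smult_l_minus[of 1 v] smult_one[of v] assms(2) by simp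
qed

lemma complex_module_minus:
  assumes "module complex_ring V" "w \<in> carrier V"
  shows "v \<ominus>\<^bsub>V\<^esub> w = v \<oplus>\<^bsub>V\<^esub> (- 1) \<odot>\<^bsub>V\<^esub> w"
  using complex_module_uminus[OF assms] by (simp add: a_minus_def)

text \<open>
  Negatives come for free over \<open>\<complex>\<close>: they are multiples by \<open>- 1\<close>.
\<close>

lemma complex_submoduleI:
  assumes V: "module complex_ring V"
    and "H \<subseteq> carrier V" "\<zero>\<^bsub>V\<^esub> \<in> H"
    and "\<And>v w. v \<in> H \<Longrightarrow> w \<in> H \<Longrightarrow> v \<oplus>\<^bsub>V\<^esub> w \<in> H"
    and smult: "\<And>c v. v \<in> H \<Longrightarrow> c \<odot>\<^bsub>V\<^esub> v \<in> H"
  shows "submodule H complex_ring V"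
proof -
  interpret module complex_ring V by fact
  show ?thesis
    using assms complex_module_uminus[OF V] by (intro submoduleI) auto
qed

lemma lie_supermodule_module:
  "lie_supermodule G V \<Longrightarrow> module complex_ring V"
  unfolding lie_supermodule_def super_vector_space_def by blast

lemma lie_supermodule_grade_closed:
  assumes "lie_supermodule G V"
  shows "grade V a \<subseteq> carrier V"
  using assms lie_supermodule_module[OF assms]
  unfolding lie_supermodule_def super_vector_space_def super_vector_space_axioms_def
  by (metis module.submoduleE(1))

lemma lie_superalgebra_grade_closed:
  assumes "lie_superalgebra G"
  shows "grade G a \<subseteq> carrier G"
  using assms
  unfolding lie_superalgebra_def super_vector_space_def super_vector_space_axioms_def
  by (metis module.submoduleE(1))

lemma lie_superalgebra_bracket_closed:
  assumes "lie_superalgebra G" "x \<in> carrier G" "y \<in> carrier G"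
  shows "bracket G x y \<in> carrier G"
  using lie_superalgebra.bracket_bilinear[OF assms(1)] assms(2,3) by (auto simp: bilinear_map_def)

text \<open>
  The closure conditions and equations in the axioms pass to images. The one axiom that does not is
  that the two homogeneous parts meet trivially, because the kernel of \<open>h\<close> need not be graded; so it
  is a hypothesis on \<open>W\<close>. Otherwise \<open>W\<close> only has to carry operations that \<open>h\<close> respects, so this is a way
  of proving that a structure is a supermodule.
\<close>

lemma lie_supermodule_image:
  assumes V: "lie_supermodule G V"
    and onto: "h ` carrier V = carrier W"
    and zero: "h \<zero>\<^bsub>V\<^esub> = \<zero>\<^bsub>W\<^esub>"
    and add: "\<And>v w. v \<in> carrier V \<Longrightarrow> w \<in> carrier V \<Longrightarrow> h (v \<oplus>\<^bsub>V\<^esub> w) = h v \<oplus>\<^bsub>W\<^esub> h w"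
    and smult: "\<And>c v. v \<in> carrier V \<Longrightarrow> h (c \<odot>\<^bsub>V\<^esub> v) = c \<odot>\<^bsub>W\<^esub> h v"
    and act: "\<And>x v. x \<in> carrier G \<Longrightarrow> v \<in> carrier V \<Longrightarrow> h (action V x v) = action W x (h v)"
    and grade: "\<And>a. h ` grade V a = grade W a"
    and grade_int: "grade W 0 \<inter> grade W 1 \<subseteq> {\<zero>\<^bsub>W\<^esub>}"
  shows "lie_supermodule G W"
proof -
  have alg: "lie_superalgebra G" using V by (simp add: lie_supermodule_def)
  have sub: "\<And>a. submodule (grade V a) complex_ring V"
    and sum: "grade V 0 <+>\<^bsub>V\<^esub> grade V 1 = carrier V"
    and int: "grade V 0 \<inter> grade V 1 = {\<zero>\<^bsub>V\<^esub>}"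
    using V unfolding lie_supermodule_def super_vector_space_def super_vector_space_axioms_def
    by blast+
  interpret V: module complex_ring V by (rule lie_supermodule_module[OF V])
  interpret G: module complex_ring G
    using alg by (simp add: lie_superalgebra_def super_vector_space_def)
  note bil = lie_supermodule.action_bilinear[OF V, unfolded bilinear_map_def]
  have act_closed: "action V x v \<in> carrier V" if "x \<in> carrier G" "v \<in> carrier V" for x v
    using bil that by blast
  have hc [simp]: "h v \<in> carrier W" if "v \<in> carrier V" for v
    using onto that by blast
  have lift: "P w" if "w \<in> carrier W" "\<And>v. v \<in> carrier V \<Longrightarrow> P (h v)" for P w
    using that(1) unfolding onto[symmetric] by (elim imageE) (simp add: that(2))
  have gV: "grade V a \<subseteq> carrier V" for a by (rule lie_supermodule_grade_closed[OF V])
  have gG: "grade G a \<subseteq> carrier G" for a by (rule lie_superalgebra_grade_closed[OF alg])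
  have addW [simp]: "h v \<oplus>\<^bsub>W\<^esub> h w = h (v \<oplus>\<^bsub>V\<^esub> w)" if "v \<in> carrier V" "w \<in> carrier V" for v w
    using add that by simp
  have smultW [simp]: "c \<odot>\<^bsub>W\<^esub> h v = h (c \<odot>\<^bsub>V\<^esub> v)" if "v \<in> carrier V" for c v
    using smult that by simp
  have actW [simp]: "action W x (h v) = h (action V x v)" if "x \<in> carrier G" "v \<in> carrier V" for x v
    using act that by simp
  have abW: "abelian_group W"
  proof (rule abelian_groupI)
    show "\<zero>\<^bsub>W\<^esub> \<in> carrier W" by (simp flip: zero)
    fix x assume "x \<in> carrier W"
    then show "\<zero>\<^bsub>W\<^esub> \<oplus>\<^bsub>W\<^esub> x = x" by (rule lift) (simp flip: zero)
    show "\<exists>y\<in>carrier W. y \<oplus>\<^bsub>W\<^esub> x = \<zero>\<^bsub>W\<^esub>"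
      using \<open>x \<in> carrier W\<close>
    proof (rule lift)
      fix v assume v: "v \<in> carrier V"
      then have "h (\<ominus>\<^bsub>V\<^esub> v) \<oplus>\<^bsub>W\<^esub> h v = \<zero>\<^bsub>W\<^esub>" by (simp add: V.l_neg zero)
      with v show "\<exists>y\<in>carrier W. y \<oplus>\<^bsub>W\<^esub> h v = \<zero>\<^bsub>W\<^esub>" by (blast intro: hc V.a_inv_closed)
    qed
    fix y assume "y \<in> carrier W"
    with \<open>x \<in> carrier W\<close> obtain v w where
      vw: "v \<in> carrier V" "w \<in> carrier V" "x = h v" "y = h w"
      unfolding onto[symmetric] by (elim imageE)
    then show "x \<oplus>\<^bsub>W\<^esub> y \<in> carrier W" "x \<oplus>\<^bsub>W\<^esub> y = y \<oplus>\<^bsub>W\<^esub> x"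
      by (simp_all add: V.a_comm)
    fix z assume "z \<in> carrier W"
    then show "x \<oplus>\<^bsub>W\<^esub> y \<oplus>\<^bsub>W\<^esub> z = x \<oplus>\<^bsub>W\<^esub> (y \<oplus>\<^bsub>W\<^esub> z)"
      by (rule lift) (simp add: vw V.a_assoc)
  qed
  have modW: "module complex_ring W"
  proof (rule moduleI[OF cring_from_type_algebra abW])
    fix c d :: complex and x y
    assume x: "x \<in> carrier W" 
    show "c \<odot>\<^bsub>W\<^esub> x \<in> carrier W" "\<one>\<^bsub>complex_ring\<^esub> \<odot>\<^bsub>W\<^esub> x = x"
      "(c \<oplus>\<^bsub>complex_ring\<^esub> d) \<odot>\<^bsub>W\<^esub> x = c \<odot>\<^bsub>W\<^esub> x \<oplus>\<^bsub>W\<^esub> d \<odot>\<^bsub>W\<^esub> x"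
      "(c \<otimes>\<^bsub>complex_ring\<^esub> d) \<odot>\<^bsub>W\<^esub> x = c \<odot>\<^bsub>W\<^esub> (d \<odot>\<^bsub>W\<^esub> x)"
      using x V.smult_l_distr V.smult_assoc1 V.smult_one by (auto simp flip: onto)
    assume "y \<in> carrier W"
    with x show "c \<odot>\<^bsub>W\<^esub> (x \<oplus>\<^bsub>W\<^esub> y) = c \<odot>\<^bsub>W\<^esub> x \<oplus>\<^bsub>W\<^esub> c \<odot>\<^bsub>W\<^esub> y"
      using V.smult_r_distr by (auto simp flip: onto)
  qed
  have supW: "super_vector_space W"
  proof (intro super_vector_space.intro super_vector_space_axioms.intro modW)
    fix a
    note subE = V.submoduleE[OF sub[of a]]
    show "submodule (grade W a) complex_ring W"
    proof (rule complex_submoduleI[OF modW])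
      show "grade W a \<subseteq> carrier W" using gV onto grade by blast
      show "\<zero>\<^bsub>W\<^esub> \<in> grade W a"
        using submodule.axioms(1)[OF sub[of a]] subgroup.one_closed zero grade
        by (metis imageI monoid.select_convs(2))
      fix x assume "x \<in> grade W a"
      then obtain v where v: "v \<in> grade V a" "x = h v" using grade by blast
      show "c \<odot>\<^bsub>W\<^esub> x \<in> grade W a" for c
        using v subE(4)[of c v] gV[of a] by (auto simp flip: grade)
      fix y assume "y \<in> grade W a"
      then obtain w where "w \<in> grade V a" "y = h w" using grade by blast
      then show "x \<oplus>\<^bsub>W\<^esub> y \<in> grade W a"
        using v subE(5)[of v w] gV[of a] by (auto simp: subset_iff simp flip: grade)
    qed
  next
    have "h (v \<oplus>\<^bsub>V\<^esub> w) \<in> grade W 0 <+>\<^bsub>W\<^esub> grade W 1"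
      if "v \<in> grade V 0" "w \<in> grade V 1" for v w
    proof -
      have "h v \<oplus>\<^bsub>W\<^esub> h w = h (v \<oplus>\<^bsub>V\<^esub> w)"
        using that gV[of 0] gV[of 1] by (intro addW) blast+
      moreover have "h v \<in> grade W 0" "h w \<in> grade W 1" using that by (auto simp flip: grade)
      ultimately show ?thesis unfolding set_add_def' by blast
    qed
    then have "carrier W \<subseteq> grade W 0 <+>\<^bsub>W\<^esub> grade W 1"
      by (auto simp: set_add_def' simp flip: onto sum)
    moreover have "grade W 0 <+>\<^bsub>W\<^esub> grade W 1 \<subseteq> carrier W"
      using gV[of 0] gV[of 1] by (auto simp: set_add_def' subset_iff simp flip: grade)
    ultimately show "grade W 0 <+>\<^bsub>W\<^esub> grade W 1 = carrier W" by blast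
    have "\<zero>\<^bsub>W\<^esub> \<in> grade W 0 \<inter> grade W 1" using int zero grade by (metis IntD1 IntD2 IntI image_eqI singletonI)
    with grade_int show "grade W 0 \<inter> grade W 1 = {\<zero>\<^bsub>W\<^esub>}" by blast
  qed
  have minus: "h v \<ominus>\<^bsub>W\<^esub> h w = h (v \<ominus>\<^bsub>V\<^esub> w)" if "v \<in> carrier V" "w \<in> carrier V" for v w
    using that by (simp add: complex_module_minus[OF modW] complex_module_minus[OF V.module_axioms])
  show ?thesis
  proof (intro lie_supermodule.intro lie_supermodule_axioms.intro alg supW)
    show "bilinear_map G W W (action W)"
      unfolding bilinear_map_def using bil by (auto simp flip: onto)
    fix x a assume x: "x \<in> grade G a"
    show "action W x w \<in> grade W (a + b)" if "w \<in> grade W b" for w b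
    proof -
      from that obtain v where v: "v \<in> grade V b" "w = h v" unfolding grade[symmetric] by (elim imageE)
      have "h (action V x v) \<in> grade W (a + b)"
        unfolding grade[symmetric] by (rule imageI) (rule lie_supermodule.action_grade[OF V x v(1)])
      moreover have "action W x w = h (action V x v)"
        using v x gV[of b] gG[of a] by (auto intro: actW)
      ultimately show ?thesis by simp
    qed
    fix y b w assume y: "y \<in> grade G b" and "w \<in> carrier W"
    then obtain v where v: "v \<in> carrier V" "w = h v"
      unfolding onto[symmetric] by (elim imageE)
    have xy: "x \<in> carrier G" "y \<in> carrier G" using x y gG by blast+
    then have "bracket G x y \<in> carrier G" by (rule lie_superalgebra_bracket_closed[OF alg])
    with xy v show "action W (bracket G x y) w =
        action W x (action W y w) \<ominus>\<^bsub>W\<^esub> super_sign a b \<odot>\<^bsub>W\<^esub> action W y (action W x w)"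
      using lie_supermodule.action_bracket[OF V x y v(1)] act_closed by (simp add: minus)
  qed
qed

lemma lie_supermodule_restrict:
  assumes N: "lie_subsupermodule N G V"
  shows "lie_supermodule G (restrict_supermod V N)"
proof -
  let ?R = "restrict_supermod V N"
  have V: "lie_supermodule G V" and subN: "submodule N complex_ring V"
    using N by (simp_all add: lie_subsupermodule_def)
  have alg: "lie_superalgebra G" using V by (simp add: lie_supermodule_def)
  have sub: "\<And>a. submodule (grade V a) complex_ring V"
    and int: "grade V 0 \<inter> grade V 1 = {\<zero>\<^bsub>V\<^esub>}"
    using V unfolding lie_supermodule_def super_vector_space_def super_vector_space_axioms_def
    by blast+
  interpret V: module complex_ring V by (rule lie_supermodule_module[OF V])
  have NV: "N \<subseteq> carrier V" by (rule V.submoduleE(1)[OF subN])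
  have zero: "\<zero>\<^bsub>V\<^esub> \<in> N" "\<zero>\<^bsub>V\<^esub> \<in> grade V a" for a
    using submodule.axioms(1)[OF subN] submodule.axioms(1)[OF sub[of a]] subgroup.one_closed
    by (metis monoid.select_convs(2))+
  have R [simp]: "carrier ?R = N" "\<zero>\<^bsub>?R\<^esub> = \<zero>\<^bsub>V\<^esub>" "add ?R = add V" "module.smult ?R = module.smult V"
      "action ?R = action V" "grade ?R = (\<lambda>a. N \<inter> grade V a)"
    by (simp_all add: restrict_supermod_def)
  have gG: "grade G a \<subseteq> carrier G" for a by (rule lie_superalgebra_grade_closed[OF alg])
  have modR: "module complex_ring ?R"
  proof -
    have "module complex_ring (V\<lparr>carrier := N\<rparr>)"
      by (rule submodule.submodule_is_module[OF subN V.module_axioms])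
    then show ?thesis
      by (simp add: module_def abelian_group_def abelian_monoid_def abelian_group_axioms_def
          module_axioms_def restrict_supermod_def)
  qed
  have supR: "super_vector_space ?R"
  proof (intro super_vector_space.intro super_vector_space_axioms.intro modR)
    show "submodule (grade ?R a) complex_ring ?R" for a
      by (rule complex_submoduleI[OF modR])
        (use zero V.submoduleE(4,5)[OF subN] V.submoduleE(4,5)[OF sub[of a]] in auto)
    show "grade ?R 0 <+>\<^bsub>?R\<^esub> grade ?R 1 = carrier ?R"
      using lie_subsupermodule.sub_graded[OF N] by (simp add: set_add_def')
    show "grade ?R 0 \<inter> grade ?R 1 = {\<zero>\<^bsub>?R\<^esub>}" using int zero by auto
  qed
  note actN = lie_subsupermodule.sub_action[OF N]
  have minus: "v \<ominus>\<^bsub>?R\<^esub> w = v \<ominus>\<^bsub>V\<^esub> w" if "v \<in> N" "w \<in> N" for v w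
    using that NV
    by (simp add: complex_module_minus[OF modR] complex_module_minus[OF V.module_axioms] subset_iff)
  show ?thesis
  proof (intro lie_supermodule.intro lie_supermodule_axioms.intro alg supR)
    show "bilinear_map G ?R ?R (action ?R)"
      using lie_supermodule.action_bilinear[OF V] actN NV
      unfolding bilinear_map_def R by (simp add: subset_iff)
    fix x a assume x: "x \<in> grade G a"
    show "action ?R x w \<in> grade ?R (a + b)" if "w \<in> grade ?R b" for w b
      using that x lie_supermodule.action_grade[OF V x, of w b] gG[of a] actN[of x w] by auto
    fix y b w assume y: "y \<in> grade G b" and w: "w \<in> carrier ?R"
    have xy: "x \<in> carrier G" "y \<in> carrier G" using x y gG by blast+
    show "action ?R (bracket G x y) w =
        action ?R x (action ?R y w) \<ominus>\<^bsub>?R\<^esub> super_sign a b \<odot>\<^bsub>?R\<^esub> action ?R y (action ?R x w)"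
      using lie_supermodule.action_bracket[OF V x y, of w] w NV actN xy V.submoduleE(4)[OF subN]
      by (subst minus) auto
  qed
qed

text \<open>
  A homogeneous element of the image has a homogeneous preimage: take any preimage \<open>p + q\<close> with \<open>p\<close> of
  the right degree and \<open>q\<close> of the wrong one. Then \<open>h q\<close> has both degrees, so it vanishes and \<open>p\<close> is a
  preimage as well.
\<close>

lemma supermod_hom_image_grade:
  assumes V: "lie_supermodule G V" and W: "lie_supermodule G W"
    and h: "h \<in> supermod_hom G V W" and onto: "h ` carrier V = carrier W"
  shows "h ` grade V a = grade W a"
proof
  interpret W: module complex_ring W by (rule lie_supermodule_module[OF W])
  show "h ` grade V a \<subseteq> grade W a" using h by (auto simp: supermod_hom_def)
  show "grade W a \<subseteq> h ` grade V a"
  proof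
    fix w assume w: "w \<in> grade W a"
    have sub: "\<And>b. submodule (grade W b) complex_ring W"
      and intW: "grade W 0 \<inter> grade W 1 = {\<zero>\<^bsub>W\<^esub>}" and sum: "grade V 0 <+>\<^bsub>V\<^esub> grade V 1 = carrier V"
      using V W unfolding lie_supermodule_def super_vector_space_def super_vector_space_axioms_def
      by blast+
    interpret V: module complex_ring V by (rule lie_supermodule_module[OF V])
    have gV: "grade V a \<subseteq> carrier V" for a by (rule lie_supermodule_grade_closed[OF V])
    have gW: "grade W a \<subseteq> carrier W" for a by (rule lie_supermodule_grade_closed[OF W])
    have "w \<in> h ` carrier V" using w gW onto by auto
    then obtain v where v: "v \<in> carrier V" "w = h v" by (elim imageE)
    with sum obtain v0 v1 where v01: "v0 \<in> grade V 0" "v1 \<in> grade V 1" "v = v0 \<oplus>\<^bsub>V\<^esub> v1"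
      unfolding set_add_def' by blast
    obtain p q where pq: "p \<in> grade V a" "q \<in> grade V (a + 1)" "v = p \<oplus>\<^bsub>V\<^esub> q"
    proof (cases a)
      case zero then show ?thesis using that v01 by auto
    next
      case one then show ?thesis using that[of v1 v0] v01 V.a_comm[of v0 v1] gV by auto
    qed
    have "h p \<in> grade W a" "h q \<in> grade W (a + 1)"
      using pq h unfolding supermod_hom_def by blast+
    then have c: "h p \<in> grade W a" "h q \<in> grade W (a + 1)" "h p \<in> carrier W" "h q \<in> carrier W"
      using gW by blast+
    have eq: "w = h p \<oplus>\<^bsub>W\<^esub> h q"
      using pq v gV h by (auto simp: supermod_hom_def subset_iff)
    then have "h q = \<ominus>\<^bsub>W\<^esub> h p \<oplus>\<^bsub>W\<^esub> w"
      using c by (simp add: W.r_neg1)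
    then have "h q \<in> grade W a"
      using w c W.submoduleE(3,5)[OF sub] by auto
    with c intW have "h q = \<zero>\<^bsub>W\<^esub>" by (cases a) auto
    with eq c have "w = h p" by simp
    with pq show "w \<in> h ` grade V a" by blast
  qed
qed

text \<open>
  The cosets of the kernel are the fibres of \<open>h\<close>, so \<open>w \<mapsto> h\<^sup>-\<^sup>1{w}\<close> is a bijection from \<open>W\<close> onto the
  quotient. It transports all operations of \<open>W\<close> to those of the quotient. This is the inverse of the
  usual induced map. Going in this direction shows at once that the operations on cosets, which are
  unions over representatives, are well defined; by \<open>lie_supermodule_image\<close> the quotient is a supermodule.
\<close>

lemma quotient_supermod_kernel_isomorphic:
  fixes V :: "('g, 'a) lie_supermod"
  assumes V: "lie_supermodule G V" and W: "lie_supermodule G W"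
    and h: "h \<in> supermod_hom G V W" and onto: "h ` carrier V = carrier W"
  shows "supermod_isomorphic G (quotient_supermod V {v \<in> carrier V. h v = \<zero>\<^bsub>W\<^esub>}) W"
proof -
  define N where "N = {v \<in> carrier V. h v = \<zero>\<^bsub>W\<^esub>}"
  define fib where "fib w = {v \<in> carrier V. h v = w}" for w
  let ?Q = "quotient_supermod V N"
  interpret V: module complex_ring V by (rule lie_supermodule_module[OF V])
  interpret W: module complex_ring W by (rule lie_supermodule_module[OF W])
  have hc [simp]: "h v \<in> carrier W" if "v \<in> carrier V" for v using onto that by blast
  have add [simp]: "h (v \<oplus>\<^bsub>V\<^esub> w) = h v \<oplus>\<^bsub>W\<^esub> h w" if "v \<in> carrier V" "w \<in> carrier V" for v w
    using h that by (auto simp: supermod_hom_def)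
  have smult [simp]: "h (c \<odot>\<^bsub>V\<^esub> v) = c \<odot>\<^bsub>W\<^esub> h v" if "v \<in> carrier V" for c v
    using h that by (auto simp: supermod_hom_def)
  have act [simp]: "h (action V x v) = action W x (h v)" if "x \<in> carrier G" "v \<in> carrier V" for x v
    using h that by (auto simp: supermod_hom_def)
  have actV [simp]: "action V x v \<in> carrier V" if "x \<in> carrier G" "v \<in> carrier V" for x v
    using lie_supermodule.action_bilinear[OF V] that by (auto simp: bilinear_map_def)
  have gV: "grade V a \<subseteq> carrier V" for a by (rule lie_supermodule_grade_closed[OF V])
  have grade: "h ` grade V a = grade W a" for a
    by (rule supermod_hom_image_grade[OF V W h onto])
  have uminus: "h (\<ominus>\<^bsub>V\<^esub> v) = \<ominus>\<^bsub>W\<^esub> h v" if "v \<in> carrier V" for v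
    using that by (simp add: complex_module_uminus[OF V.module_axioms]
        complex_module_uminus[OF W.module_axioms])
  have coset: "N +>\<^bsub>V\<^esub> v = fib (h v)" if v: "v \<in> carrier V" for v
  proof
    show "N +>\<^bsub>V\<^esub> v \<subseteq> fib (h v)"
      using v by (auto simp: a_r_coset_def' N_def fib_def)
    show "fib (h v) \<subseteq> N +>\<^bsub>V\<^esub> v"
    proof
      fix u assume "u \<in> fib (h v)"
      then have u: "u \<in> carrier V" "h u = h v" by (auto simp: fib_def)
      with v have "u \<oplus>\<^bsub>V\<^esub> \<ominus>\<^bsub>V\<^esub> v \<in> N" by (simp add: N_def uminus W.r_neg)
      moreover have "u = u \<oplus>\<^bsub>V\<^esub> \<ominus>\<^bsub>V\<^esub> v \<oplus>\<^bsub>V\<^esub> v" using u v by (simp add: V.a_assoc V.l_neg)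
      ultimately show "u \<in> N +>\<^bsub>V\<^esub> v" unfolding a_r_coset_def' by blast
    qed
  qed
  have h_fib: "h ` fib w = {w}" if "w \<in> carrier W" for w
  proof -
    from that have "w \<in> h ` carrier V" by (simp only: onto)
    then obtain v where "v \<in> carrier V" "w = h v" by (rule imageE)
    then have "w \<in> h ` fib w" by (intro image_eqI[of _ _ v]) (simp_all add: fib_def)
    moreover have "h ` fib w \<subseteq> {w}" by (auto simp: fib_def)
    ultimately show ?thesis by blast
  qed
  have the_fib: "the_elem (h ` fib w) = w" if "w \<in> carrier W" for w
    using h_fib[OF that] by simp
  have inj: "inj_on fib (carrier W)" by (rule inj_on_inverseI) (rule the_fib)
  have ne: "fib w \<noteq> {}" if "w \<in> carrier W" for w using h_fib[OF that] by blast
  have carQ: "fib ` carrier W = carrier ?Q"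
    by (auto simp: quotient_supermod_def A_RCOSETS_def' coset simp flip: onto)
  have zeroQ: "fib \<zero>\<^bsub>W\<^esub> = \<zero>\<^bsub>?Q\<^esub>" by (simp add: quotient_supermod_def fib_def N_def)
  have addQ: "fib (w \<oplus>\<^bsub>W\<^esub> z) = fib w \<oplus>\<^bsub>?Q\<^esub> fib z" if w: "w \<in> carrier W" and z: "z \<in> carrier W" for w z
  proof -
    have "u \<in> set_add V (fib w) (fib z)" if u: "u \<in> fib (w \<oplus>\<^bsub>W\<^esub> z)" for u
    proof -
      obtain v where v: "v \<in> fib w" using ne[OF w] by blast
      have c: "u \<in> carrier V" "v \<in> carrier V" "h v = w" "h u = w \<oplus>\<^bsub>W\<^esub> z"
        using u v by (auto simp: fib_def)
      then have "\<ominus>\<^bsub>V\<^esub> v \<oplus>\<^bsub>V\<^esub> u \<in> fib z"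
        using w z by (simp add: fib_def uminus W.r_neg1)
      moreover have "u = v \<oplus>\<^bsub>V\<^esub> (\<ominus>\<^bsub>V\<^esub> v \<oplus>\<^bsub>V\<^esub> u)" using c by (simp add: V.r_neg2)
      ultimately show ?thesis using v unfolding set_add_def' by blast
    qed
    then show ?thesis by (auto simp: quotient_supermod_def set_add_def' fib_def)
  qed
  have smultQ: "fib (c \<odot>\<^bsub>W\<^esub> w) = c \<odot>\<^bsub>?Q\<^esub> fib w" if "w \<in> carrier W" for c w
  proof -
    have "N +>\<^bsub>V\<^esub> (c \<odot>\<^bsub>V\<^esub> v) = fib (c \<odot>\<^bsub>W\<^esub> w)" if "v \<in> fib w" for v
      using that by (auto simp: fib_def[of w] coset)
    then show ?thesis using ne[OF that] by (simp add: quotient_supermod_def)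
  qed
  have actQ: "fib (action W x w) = action ?Q x (fib w)" if "x \<in> carrier G" "w \<in> carrier W" for x w
  proof -
    have "N +>\<^bsub>V\<^esub> action V x v = fib (action W x w)" if "v \<in> fib w" for v
      using that \<open>x \<in> carrier G\<close> by (auto simp: fib_def[of w] coset)
    then show ?thesis using ne[OF that(2)] by (simp add: quotient_supermod_def)
  qed
  have gradeQ: "fib ` grade W a = grade ?Q a" for a
    using gV[of a] by (auto simp: quotient_supermod_def image_image coset subset_iff simp flip: grade
        intro!: image_cong)
  have intW: "grade W 0 \<inter> grade W 1 = {\<zero>\<^bsub>W\<^esub>}"
    using W unfolding lie_supermodule_def super_vector_space_def super_vector_space_axioms_def
    by blast
  have gW: "grade W a \<subseteq> carrier W" for a by (rule lie_supermodule_grade_closed[OF W])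
  have intQ: "grade ?Q 0 \<inter> grade ?Q 1 \<subseteq> {\<zero>\<^bsub>?Q\<^esub>}"
    using inj_on_image_Int[OF inj gW[of 0] gW[of 1]] by (simp add: gradeQ intW zeroQ)
  have Q: "lie_supermodule G ?Q"
    by (rule lie_supermodule_image[OF W carQ zeroQ addQ smultQ actQ gradeQ intQ])
  define k where "k = (\<lambda>A. the_elem (h ` A))"
  have k: "k (fib w) = w" if "w \<in> carrier W" for w using that the_fib by (simp add: k_def)
  have lift: "P A" if "A \<in> carrier ?Q" "\<And>w. w \<in> carrier W \<Longrightarrow> P (fib w)" for P A
    using that(1) unfolding carQ[symmetric] by (elim imageE) (simp add: that(2))
  have actW: "action W x w \<in> carrier W" if "x \<in> carrier G" "w \<in> carrier W" for x w
    using lie_supermodule.action_bilinear[OF W] that by (auto simp: bilinear_map_def)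
  have "k \<in> supermod_hom G ?Q W"
    unfolding supermod_hom_def mem_Collect_eq Pi_iff
  proof (intro conjI ballI allI)
    fix A assume A: "A \<in> carrier ?Q"
    then show "k A \<in> carrier W" by (rule lift) (simp add: k)
    from A show "k (c \<odot>\<^bsub>?Q\<^esub> A) = c \<odot>\<^bsub>W\<^esub> k A" for c
      by (rule lift) (simp add: k flip: smultQ)
    from A show "k (action ?Q x A) = action W x (k A)" if "x \<in> carrier G" for x
      by (rule lift) (use that in \<open>simp add: k actW flip: actQ\<close>)
    fix B assume "B \<in> carrier ?Q"
    with A obtain w z where "w \<in> carrier W" "z \<in> carrier W" "A = fib w" "B = fib z"
      unfolding carQ[symmetric] by (elim imageE)
    then show "k (A \<oplus>\<^bsub>?Q\<^esub> B) = k A \<oplus>\<^bsub>W\<^esub> k B" by (simp add: k flip: addQ)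
  next
    fix a A assume "A \<in> grade ?Q a"
    then show "k A \<in> grade W a" using gW by (auto simp: k subset_iff simp flip: gradeQ)
  qed
  moreover have "bij_betw k (carrier ?Q) (carrier W)"
    by (rule bij_betw_byWitness[where f' = fib]) (use k in \<open>auto simp flip: carQ\<close>)
  ultimately show ?thesis
    using Q W unfolding supermod_isomorphic_def N_def by blast
qed

section \<open>The Fermion-Virasoro algebra\<close>

text \<open>
  The bracket and the module actions are all linear extensions of their values on the basis of \<open>fv\<close>;
  this is the common form.
\<close>

definition linext :: "(complex \<Rightarrow> 'a \<Rightarrow> 'a) \<Rightarrow> ('i \<Rightarrow> 'a) \<Rightarrow> ('i \<Rightarrow>\<^sub>0 complex) \<Rightarrow> 'a::comm_monoid_add"
  where "linext sc A u = (\<Sum>i\<in>Poly_Mapping.keys u. sc (Poly_Mapping.lookup u i) (A i))"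

lemma lookup_fv_scale [simp]: "Poly_Mapping.lookup (fv_scale c u) i = c * Poly_Mapping.lookup u i"
  by (cases "Poly_Mapping.lookup u i = 0") (simp_all add: fv_scale_def Poly_Mapping.map.rep_eq)

lemma vector_space_fv_scale: "vector_space fv_scale"
  by unfold_locales (auto intro!: poly_mapping_eqI simp: lookup_add algebra_simps)

lemma fv_scale_single [simp]:
  "fv_scale c (Poly_Mapping.single i d) = Poly_Mapping.single i (c * d)"
  by (auto intro!: poly_mapping_eqI simp: lookup_single when_def)

lemma keys_fv_scale_subset: "Poly_Mapping.keys (fv_scale c u) \<subseteq> Poly_Mapping.keys u"
  by (auto simp: in_keys_iff)

locale linear_extension = vector_space sc for sc :: "complex \<Rightarrow> 'a::ab_group_add \<Rightarrow> 'a"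
begin

text \<open>
  Different elements have different key sets; summing over a common superset makes them comparable.
\<close>

lemma linext_superset:
  assumes "finite I" "Poly_Mapping.keys u \<subseteq> I"
  shows "linext sc A u = (\<Sum>i\<in>I. sc (Poly_Mapping.lookup u i) (A i))"
  unfolding linext_def using assms by (intro sum.mono_neutral_left) (auto simp: in_keys_iff)

lemma linext_add: "linext sc A (u + v) = linext sc A u + linext sc A v"
proof -
  let ?I = "Poly_Mapping.keys u \<union> Poly_Mapping.keys v"
  have "linext sc A w = (\<Sum>i\<in>?I. sc (Poly_Mapping.lookup w i) (A i))"
    if "w \<in> {u, v, u + v}" for w
    using that Poly_Mapping.keys_add[of u v] by (intro linext_superset) auto
  then show ?thesis by (simp add: lookup_add scale_left_distrib sum.distrib)
qed

lemma linext_scale: "linext sc A (fv_scale c u) = sc c (linext sc A u)"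
  using linext_superset[OF _ keys_fv_scale_subset, of u A c]
  by (simp add: linext_def[of sc A u] scale_sum_right)

lemma linext_single [simp]: "linext sc A (Poly_Mapping.single i c) = sc c (A i)"
  by (simp add: linext_def)

lemma linext_0 [simp]: "linext sc A 0 = 0"
  by (simp add: linext_def)

lemma linext_add_fun: "linext sc (\<lambda>i. A i + B i) u = linext sc A u + linext sc B u"
  by (simp add: linext_def scale_right_distrib sum.distrib)

lemma linext_scale_fun: "linext sc (\<lambda>i. sc c (A i)) u = sc c (linext sc A u)"
  by (simp add: linext_def scale_sum_right mult.commute)

end

interpretation fv: linear_extension fv_scale
  by (intro linear_extension.intro vector_space_fv_scale)

lemma fv_bracket_linext:
  "fv_bracket u v = linext fv_scale (\<lambda>i. linext fv_scale (fv_basis_bracket i) v) u"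
  by (simp add: fv_bracket_def linext_def fv.scale_sum_right)

lemma fv_bracket_simps:
  "fv_bracket (u + u') v = fv_bracket u v + fv_bracket u' v"
  "fv_bracket u (v + v') = fv_bracket u v + fv_bracket u v'"
  "fv_bracket (fv_scale c u) v = fv_scale c (fv_bracket u v)"
  "fv_bracket u (fv_scale c v) = fv_scale c (fv_bracket u v)"
  "fv_bracket 0 v = 0" "fv_bracket u 0 = 0"
  by (simp_all add: fv_bracket_linext fv.linext_add fv.linext_scale fv.linext_add_fun fv.linext_scale_fun)
     (simp add: linext_def)

lemma fv_bracket_single [simp]:
  "fv_bracket (Poly_Mapping.single i c) (Poly_Mapping.single j d) =
    fv_scale (c * d) (fv_basis_bracket i j)"
  by (simp add: fv_bracket_linext)

definition fv_grade :: "bit \<Rightarrow> fv set"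
  where "fv_grade a = {u. \<forall>i\<in>Poly_Mapping.keys u. fv_parity i = a}"

lemma fv_algebra_simps [simp]:
  "carrier fv_algebra = UNIV" "\<zero>\<^bsub>fv_algebra\<^esub> = 0" "add fv_algebra = (+)"
  "module.smult fv_algebra = fv_scale" "grade fv_algebra = fv_grade" "bracket fv_algebra = fv_bracket"
  by (simp_all add: fv_algebra_def fv_grade_def fun_eq_iff)

text \<open>
  An identity that is linear in \<open>u\<close> needs to be checked only at basis elements. The predicate \<open>S\<close>
  confines the induction to a span, in practice a homogeneous part.
\<close>

lemma fv_span_induct [consumes 1, case_names zero add single]:
  assumes "\<forall>i\<in>Poly_Mapping.keys u. S i"
    and "P 0" "\<And>u v. P u \<Longrightarrow> P v \<Longrightarrow> P (u + v)"
    and "\<And>i c. S i \<Longrightarrow> P (fv_scale c (Poly_Mapping.single i 1))"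
  shows "P u"
proof -
  have u: "u = (\<Sum>i\<in>Poly_Mapping.keys u. Poly_Mapping.single i (Poly_Mapping.lookup u i))"
  proof (rule poly_mapping_eqI)
    fix k
    show "Poly_Mapping.lookup u k = Poly_Mapping.lookup
        (\<Sum>i\<in>Poly_Mapping.keys u. Poly_Mapping.single i (Poly_Mapping.lookup u i)) k"
      by (simp add: lookup_sum lookup_single when_def in_keys_iff)
  qed
  have "P (\<Sum>i\<in>I. Poly_Mapping.single i (Poly_Mapping.lookup u i))"
    if "finite I" "I \<subseteq> Poly_Mapping.keys u" for I
    using that
  proof (induction I)
    case (insert i I)
    then have "P (fv_scale (Poly_Mapping.lookup u i) (Poly_Mapping.single i 1))"
      using assms(1,4) by blast
    with insert show ?case by (auto intro!: assms(3))
  qed (simp add: assms(2))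
  from this[OF _ order_refl] show ?thesis by (subst u) simp
qed

lemma fv_grade_induct [consumes 1, case_names zero add single]:
  assumes "u \<in> fv_grade a" and "P 0" "\<And>u v. P u \<Longrightarrow> P v \<Longrightarrow> P (u + v)"
    and "\<And>i c. fv_parity i = a \<Longrightarrow> P (fv_scale c (Poly_Mapping.single i 1))"
  shows "P u"
  using fv_span_induct[of u "\<lambda>i. fv_parity i = a" P] assms by (auto simp: fv_grade_def)

lemma fv_basis_bracket_grade: "fv_basis_bracket i j \<in> fv_grade (fv_parity i + fv_parity j)"
  by (induction i j rule: fv_basis_bracket.induct)
    (auto simp: fv_grade_def in_keys_iff lookup_add lookup_single when_def split: if_splits)

lemma fv_grade_0 [simp]: "0 \<in> fv_grade a"
  by (simp add: fv_grade_def)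

lemma fv_grade_add: "u \<in> fv_grade a \<Longrightarrow> v \<in> fv_grade a \<Longrightarrow> u + v \<in> fv_grade a"
  using Poly_Mapping.keys_add[of u v] by (auto simp: fv_grade_def)

lemma fv_grade_scale: "u \<in> fv_grade a \<Longrightarrow> fv_scale c u \<in> fv_grade a"
  using keys_fv_scale_subset[of c u] by (auto simp: fv_grade_def)

lemma fv_bracket_grade:
  assumes "u \<in> fv_grade a" "v \<in> fv_grade b"
  shows "fv_bracket u v \<in> fv_grade (a + b)"
  using assms(1)
proof (induction u rule: fv_grade_induct)
  case (single i c)
  from assms(2) show ?case
  proof (induction v rule: fv_grade_induct)
    case (single j d)
    then show ?case using fv_basis_bracket_grade[of i j] \<open>fv_parity i = a\<close>
      by (auto intro!: fv_grade_scale)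
  qed (simp_all add: fv_bracket_simps fv_grade_add)
qed (simp_all add: fv_bracket_simps fv_grade_add)

lemma fv_basis_skew:
  "fv_basis_bracket i j = fv_scale (- super_sign (fv_parity i) (fv_parity j)) (fv_basis_bracket j i)"
proof (cases "\<exists>m n. i = L m \<and> j = L n")
  case True
  then obtain m n where ij: "i = L m" "j = L n" by blast
  show ?thesis
  proof (cases "m + n = 0")
    case True
    then have "n = - m" by simp
    then show ?thesis
      by (auto intro!: poly_mapping_eqI simp: ij super_sign_def lookup_add lookup_single when_def
          power3_eq_cube field_simps)
  next
    case False
    then show ?thesis
      by (auto intro!: poly_mapping_eqI simp: ij super_sign_def lookup_single when_def add.commute)
  qed
next
  case False
  then show ?thesis
    by (cases i; cases j) (auto intro!: poly_mapping_eqI simp: super_sign_def lookup_single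
        when_def algebra_simps)
qed

lemma fv_bracket_skew:
  assumes "u \<in> fv_grade a" "v \<in> fv_grade b"
  shows "fv_bracket u v = fv_scale (- super_sign a b) (fv_bracket v u)"
  using assms(1)
proof (induction u rule: fv_grade_induct)
  case (single i c)
  from assms(2) show ?case
  proof (induction v rule: fv_grade_induct)
    case (single j d)
    then show ?case using fv_basis_skew[of i j] \<open>fv_parity i = a\<close>
      by (simp add: fv_bracket_simps)
  qed (simp_all add: fv_bracket_simps fv.scale_right_distrib)
qed (simp_all add: fv_bracket_simps fv.scale_right_distrib)

text \<open>
  The central coefficients of \<open>[L\<^sub>m, L\<^sub>n]\<close> and, below, of \<open>[Q\<^sub>p, Q\<^sub>q]\<close>. With the case distinctions
  moved into coefficients, all brackets of basis elements are sums of monomials.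
\<close>

definition virasoro_cocycle :: "int \<Rightarrow> int \<Rightarrow> complex"
  where "virasoro_cocycle m n = (if m + n = 0 then of_int (m ^ 3 - m) / 12 else 0)"

lemma fv_basis_bracket_LL:
  "fv_basis_bracket (L m) (L n) =
     Poly_Mapping.single (L (m + n)) (of_int (m - n)) + Poly_Mapping.single C1 (virasoro_cocycle m n)"
  by (simp add: virasoro_cocycle_def)

text \<open>
  All three terms vanish unless \<open>m + n + r = 0\<close>, and then this is a polynomial identity in \<open>m\<close> and \<open>n\<close>.
\<close>

lemma virasoro_cocycle_identity:
  "of_int (n - r) * virasoro_cocycle m (n + r) =
    of_int (m - n) * virasoro_cocycle (m + n) r + of_int (m - r) * virasoro_cocycle n (m + r)"
proof (cases "m + n + r = 0")
  case True
  then have r: "r = - m - n" by simp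
  show ?thesis by (simp add: virasoro_cocycle_def r field_simps power3_eq_cube)
next
  case False
  then show ?thesis by (simp add: virasoro_cocycle_def add.commute add.left_commute)
qed

lemma fv_basis_jacobi_LLL:
  "fv_bracket (Poly_Mapping.single (L m) 1) (fv_basis_bracket (L n) (L r)) =
     fv_bracket (fv_basis_bracket (L m) (L n)) (Poly_Mapping.single (L r) 1) +
     fv_bracket (Poly_Mapping.single (L n) 1) (fv_basis_bracket (L m) (L r))"
proof -
  have l: "fv_bracket (Poly_Mapping.single (L a) 1) (fv_basis_bracket (L b) (L c)) =
      Poly_Mapping.single (L (a + b + c)) (of_int (b - c) * of_int (a - (b + c))) +
      Poly_Mapping.single C1 (of_int (b - c) * virasoro_cocycle a (b + c))" for a b c
    unfolding fv_basis_bracket_LL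
    by (simp add: fv_bracket_simps fv_basis_bracket_LL fv.scale_right_distrib add.assoc
        del: fv_basis_bracket.simps(1) of_int_diff of_int_add)
  have r: "fv_bracket (fv_basis_bracket (L a) (L b)) (Poly_Mapping.single (L c) 1) =
      Poly_Mapping.single (L (a + b + c)) (of_int (a - b) * of_int (a + b - c)) +
      Poly_Mapping.single C1 (of_int (a - b) * virasoro_cocycle (a + b) c)" for a b c
    unfolding fv_basis_bracket_LL
    by (simp add: fv_bracket_simps fv_basis_bracket_LL fv.scale_right_distrib add.assoc
        del: fv_basis_bracket.simps(1) of_int_diff of_int_add)
  have w: "(of_int (n - r) * of_int (m - (n + r)) :: complex) =
      of_int (m - n) * of_int (m + n - r) + of_int (m - r) * of_int (n - (m + r))"
    by (simp add: algebra_simps)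
  show ?thesis
    unfolding l r w virasoro_cocycle_identity[of n r m] by (simp only: single_add add_ac)
qed

definition pair_Q :: "int \<Rightarrow> int \<Rightarrow> complex"
  where "pair_Q k l = (if half k + half l = 0 then 1 else 0)"

lemma fv_basis_bracket_QQ:
  "fv_basis_bracket (Q k) (Q l) = Poly_Mapping.single C3 (pair_Q k l)"
  by (simp add: pair_Q_def)

lemma fv_bracket_central [simp]:
  "fv_bracket (Poly_Mapping.single C1 c) u = 0" "fv_bracket u (Poly_Mapping.single C1 c) = 0"
  "fv_bracket (Poly_Mapping.single C3 c) u = 0" "fv_bracket u (Poly_Mapping.single C3 c) = 0"
proof -
  have "fv_basis_bracket C1 j = 0" "fv_basis_bracket j C1 = 0"
    "fv_basis_bracket C3 j = 0" "fv_basis_bracket j C3 = 0" for j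
    by (cases j; simp)+
  then show "fv_bracket (Poly_Mapping.single C1 c) u = 0" "fv_bracket u (Poly_Mapping.single C1 c) = 0"
    "fv_bracket (Poly_Mapping.single C3 c) u = 0" "fv_bracket u (Poly_Mapping.single C3 c) = 0"
    by (simp_all add: fv_bracket_linext) (simp_all add: linext_def)
qed

lemma single_eqI: "k = l \<Longrightarrow> c = d \<Longrightarrow> Poly_Mapping.single k c = Poly_Mapping.single l d"
  by simp

lemma single_eq_0I: "c = 0 \<Longrightarrow> Poly_Mapping.single k c = 0"
  by simp

text \<open>
  The form \<open>pair_Q\<close> is invariant under \<open>L\<^sub>m\<close>: both values are nonzero exactly when
  \<open>m + half k + half l = 0\<close>, and this number is also the sum of the two coefficients.
\<close>

lemma pair_Q_invariant:
  "(of_int m / 2 + half k) * pair_Q (m + k) l + (of_int m / 2 + half l) * pair_Q k (m + l) = 0"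
proof -
  have "half (m + k) + half l = of_int m + (half k + half l)"
    "half k + half (m + l) = of_int m + (half k + half l)"
    by (simp_all add: half_def)
  moreover from this have "pair_Q (m + k) l = pair_Q k (m + l)" and
    zero: "(of_int m + (half k + half l)) * pair_Q k (m + l) = 0"
    by (simp_all only: pair_Q_def) simp_all
  ultimately have "(of_int m / 2 + half k) * pair_Q (m + k) l + (of_int m / 2 + half l) * pair_Q k (m + l) =
      (of_int m / 2 + half k + (of_int m / 2 + half l)) * pair_Q k (m + l)"
    by (simp only: distrib_right)
  also have "of_int m / 2 + half k + (of_int m / 2 + half l) = of_int m + (half k + half l)"
    by simp
  finally show ?thesis using zero by simp
qed

lemma pair_Q_commute: "pair_Q k l = pair_Q l k"
  by (simp add: pair_Q_def add.commute)

lemma half_add: "half (m + k) = of_int m + half k" "half (k + m) = half k + of_int m"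
  by (simp_all add: half_def)

text \<open>
  The relation \<open>[L\<^sub>m, L\<^sub>n] = (m - n) L\<^bsub>m+n\<^esub>\<close> for the action of the \<open>L\<^sub>m\<close> on the span of the \<open>Q\<^sub>q\<close>, on the
  level of coefficients.
\<close>

lemma weight_identity:
  fixes m n q :: complex
  shows "(m - n) * (q + (m + n) / 2) = (q + m / 2) * (q + m + n / 2) - (q + n / 2) * (q + n + m / 2)"
proof -
  define a b where "a = m / 2" and "b = n / 2"
  have "m = 2 * a" "n = 2 * b" "(m + n) / 2 = a + b"
    by (simp_all add: a_def b_def add_divide_distrib)
  then show ?thesis by (simp add: algebra_simps)
qed

lemma pair_Q_transpose:
  "(- half l - of_int m / 2) * pair_Q k (m + l) = (half k + of_int m / 2) * pair_Q (m + k) l"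
proof -
  have "(- half l - of_int m / 2) * pair_Q k (m + l) = - ((of_int m / 2 + half l) * pair_Q k (m + l))"
    by (simp add: algebra_simps)
  also have "\<dots> = (of_int m / 2 + half k) * pair_Q (m + k) l"
    using pair_Q_invariant by (rule eq_neg_iff_add_eq_0[THEN iffD2, symmetric])
  finally show ?thesis by (simp only: add.commute)
qed

text \<open>
  Triples with a central element or with three odd elements give zero throughout. Three \<open>L\<close>'s need
  the cocycle identity, two \<open>L\<close>'s and one \<open>Q\<close> the relation between the weights, and one \<open>L\<close> and two
  \<open>Q\<close>'s the invariance of \<open>pair_Q\<close>.
\<close>

lemma fv_basis_jacobi:
  "fv_bracket (Poly_Mapping.single i 1) (fv_basis_bracket j k) =
     fv_bracket (fv_basis_bracket i j) (Poly_Mapping.single k 1) +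
     fv_scale (super_sign (fv_parity i) (fv_parity j))
       (fv_bracket (Poly_Mapping.single j 1) (fv_basis_bracket i k))"
proof (cases "\<exists>m n r. i = L m \<and> j = L n \<and> k = L r")
  case True
  then obtain m n r where ijk: "i = L m" "j = L n" "k = L r" by blast
  have "super_sign (fv_parity i) (fv_parity j) = 1" by (simp add: ijk super_sign_def)
  then show ?thesis
    using fv_basis_jacobi_LLL[of m n r] by (simp only: ijk fv.scale_one)
next
  case False
  then show ?thesis
    apply (cases i; cases j; cases k)
    apply (simp_all add: super_sign_def fv_bracket_simps fv_basis_bracket_LL fv_basis_bracket_QQ
        add_ac del: fv_basis_bracket.simps(1,4) flip: single_add)
    \<comment> \<open>The six surviving orders of the mixed triples remain.\<close>
    subgoal for m n k using weight_identity[of "of_int m" "of_int n" "half k"]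
      by (intro single_eqI) (simp_all add: half_add[where m = m and k = k]
          half_add[where m = n and k = k] algebra_simps)
    subgoal for m k n using weight_identity[of "of_int m" "of_int n" "half k"]
      by (intro single_eqI) (simp_all add: half_add[where m = m and k = k]
          half_add[where m = n and k = k] algebra_simps)
    subgoal for m k l using arg_cong[OF pair_Q_invariant[of m k l], of uminus]
      by (intro single_eq_0I) (simp add: algebra_simps)
    subgoal for k m n using weight_identity[of "of_int m" "of_int n" "half k"]
      by (intro single_eqI) (simp_all add: half_add[where m = m and k = k]
          half_add[where m = n and k = k] algebra_simps)
    subgoal for k m l
      by (intro single_eqI refl) (rule pair_Q_transpose[of l m k, unfolded add.commute[of m k]])
    subgoal for k l m using pair_Q_invariant[of m k l]
      by (intro single_eqI refl) (simp only: eq_neg_iff_add_eq_0 pair_Q_commute[of l "k + m"] add_ac)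
    done
qed

lemma fv_bracket_jacobi:
  assumes "u \<in> fv_grade a" "v \<in> fv_grade b"
  shows "fv_bracket u (fv_bracket v w) =
    fv_bracket (fv_bracket u v) w + fv_scale (super_sign a b) (fv_bracket v (fv_bracket u w))"
  using assms(1)
proof (induction u rule: fv_grade_induct)
  case (single i c)
  from assms(2) show ?case
  proof (induction v rule: fv_grade_induct)
    case (single j d)
    show ?case
    proof (rule fv_span_induct[of w "\<lambda>_. True"])
      fix k e
      show "fv_bracket (fv_scale c (Poly_Mapping.single i 1))
          (fv_bracket (fv_scale d (Poly_Mapping.single j 1)) (fv_scale e (Poly_Mapping.single k 1))) =
        fv_bracket (fv_bracket (fv_scale c (Poly_Mapping.single i 1))
          (fv_scale d (Poly_Mapping.single j 1))) (fv_scale e (Poly_Mapping.single k 1)) +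
        fv_scale (super_sign a b) (fv_bracket (fv_scale d (Poly_Mapping.single j 1))
          (fv_bracket (fv_scale c (Poly_Mapping.single i 1)) (fv_scale e (Poly_Mapping.single k 1))))"
        using \<open>fv_parity i = a\<close> \<open>fv_parity j = b\<close>
        by (simp add: fv_bracket_simps fv_basis_jacobi[of i j k] fv.scale_right_distrib ac_simps
            del: fv_scale_single)
    qed (simp_all add: fv_bracket_simps fv.scale_right_distrib add_ac)
  qed (simp_all add: fv_bracket_simps fv.scale_right_distrib add_ac)
qed (simp_all add: fv_bracket_simps fv.scale_right_distrib add_ac)

lemma complex_module_of_vector_space:
  assumes "carrier V = UNIV" "\<zero>\<^bsub>V\<^esub> = 0" "add V = (+)" "vector_space (module.smult V)"
  shows "module complex_ring V"
proof (rule moduleI[OF cring_from_type_algebra])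
  interpret vector_space "module.smult V" by fact
  show "abelian_group V"
    by (rule abelian_groupI) (auto simp: assms(1-3) add_ac intro: exI[of _ "- x" for x])
qed (use assms(4) in \<open>auto simp: assms(1-3) vector_space_def\<close>)

lemma super_vector_space_fv: "super_vector_space fv_algebra"
proof (intro super_vector_space.intro super_vector_space_axioms.intro)
  show mod: "module complex_ring fv_algebra"
    by (rule complex_module_of_vector_space) (simp_all add: vector_space_fv_scale)
  show "submodule (grade fv_algebra a) complex_ring fv_algebra" for a
    by (rule complex_submoduleI[OF mod]) (simp_all add: fv_grade_add fv_grade_scale)
  show "grade fv_algebra 0 \<inter> grade fv_algebra 1 = {\<zero>\<^bsub>fv_algebra\<^esub>}"
    by (auto simp: fv_grade_def intro!: keys_eq_empty[THEN iffD1])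
  have "\<exists>x\<in>fv_grade 0. \<exists>y\<in>fv_grade 1. u = x + y" for u
  proof (rule fv_span_induct[of u "\<lambda>_. True"])
    fix i c
    have "Poly_Mapping.single i 1 \<in> fv_grade (fv_parity i)" by (simp add: fv_grade_def)
    then have "fv_scale c (Poly_Mapping.single i 1) \<in> fv_grade (fv_parity i)"
      by (rule fv_grade_scale)
    then show "\<exists>x\<in>fv_grade 0. \<exists>y\<in>fv_grade 1. fv_scale c (Poly_Mapping.single i 1) = x + y"
      by (cases "fv_parity i") (metis fv_grade_0 add_0 add_0_right)+
  next
    fix u v
    assume "\<exists>x\<in>fv_grade 0. \<exists>y\<in>fv_grade 1. u = x + y" "\<exists>x\<in>fv_grade 0. \<exists>y\<in>fv_grade 1. v = x + y"
    then obtain x y x' y' where "x \<in> fv_grade 0" "y \<in> fv_grade 1" "u = x + y"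
      "x' \<in> fv_grade 0" "y' \<in> fv_grade 1" "v = x' + y'" by blast
    then show "\<exists>x\<in>fv_grade 0. \<exists>y\<in>fv_grade 1. u + v = x + y"
      by (intro bexI[of _ "x + x'"] bexI[of _ "y + y'"]) (simp_all add: fv_grade_add add_ac)
  qed (use fv_grade_0 in \<open>auto intro!: bexI[of _ 0]\<close>)
  then show "grade fv_algebra 0 <+>\<^bsub>fv_algebra\<^esub> grade fv_algebra 1 = carrier fv_algebra"
    by (auto simp: set_add_def')
qed

lemma lie_superalgebra_fv: "lie_superalgebra fv_algebra"
proof (intro lie_superalgebra.intro lie_superalgebra_axioms.intro super_vector_space_fv)
  show "bilinear_map fv_algebra fv_algebra fv_algebra (bracket fv_algebra)"
    by (simp add: bilinear_map_def fv_bracket_simps)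
qed (simp_all only: fv_algebra_simps fv_bracket_grade, erule (1) fv_bracket_skew,
    erule (1) fv_bracket_jacobi)

section \<open>The module \<open>\<Psi>\<close>\<close>

lemma const2_simps:
  "const2 0 = 0" "const2 1 = 1" "const2 (c + d) = const2 c + const2 d"
  "const2 (c * d) = const2 c * const2 d" "const2 (- c) = - const2 c"
  "const2 (c - d) = const2 c - const2 d" "const2 (of_int m) = of_int m"
  by (simp_all add: const2_def one_pCons of_int_poly)

lemma shift2_simps:
  "shift2 c (p + q) = shift2 c p + shift2 c q" "shift2 c (p * q) = shift2 c p * shift2 c q"
  "shift2 c outer_var = outer_var + const2 c" "shift2 c (inner_poly g) = inner_poly g"
  "shift2 c (const2 d) = const2 d" "shift2 c (of_int m) = of_int m" "shift2 c 0 = 0"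
  by (simp_all add: shift2_def pcompose_add pcompose_mult outer_var_def inner_poly_def const2_def
      of_int_poly pcompose_pCons)

lemma shift2_shift2: "shift2 c (shift2 d f) = shift2 (c + d) f"
proof -
  have "pcompose (outer_var + const2 d) (outer_var + const2 c) = outer_var + const2 (c + d)"
    using shift2_simps(1,3,5)[of c] unfolding shift2_def by (simp add: const2_simps add_ac)
  then show ?thesis by (simp add: shift2_def flip: pcompose_assoc)
qed

lemma vector_space_Psi_scale: "vector_space Psi_scale"
  by unfold_locales (auto simp: Psi_scale_def const2_simps algebra_simps)

interpretation psi: linear_extension Psi_scale
  by (intro linear_extension.intro vector_space_Psi_scale)

lemma Psi_scale_components [simp]:
  "fst (Psi_scale c v) = const2 c * fst v" "snd (Psi_scale c v) = const2 c * snd v"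
  by (simp_all add: Psi_scale_def)

text \<open>
  The grading that \<open>\<Psi>\<close> and \<open>\<Phi>\<close> share.
\<close>

definition pair_grade :: "bit \<Rightarrow> ('b::zero \<times> 'b) set"
  where "pair_grade a = (if a = 0 then {(f, 0) | f. True} else {(0, h) | h. True})"

lemma Psi_simps [simp]:
  "carrier (Psi lam \<beta>) = UNIV" "\<zero>\<^bsub>Psi lam \<beta>\<^esub> = 0" "add (Psi lam \<beta>) = (+)"
  "module.smult (Psi lam \<beta>) = Psi_scale" "grade (Psi lam \<beta>) = pair_grade"
  "action (Psi lam \<beta>) u v = linext Psi_scale (\<lambda>i. Psi_basis_action lam \<beta> i v) u"
  by (simp_all add: Psi_def pair_grade_def fun_eq_iff linext_def fv_linear_extension_def)

lemma Psi_basis_action_apply [simp]: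
  "Psi_basis_action lam \<beta> (L m) v =
     (const2 (lam powi m) * (outer_var + of_int m * inner_poly \<beta>) * shift2 (of_int m) (fst v),
      const2 (lam powi m) * (outer_var + of_int m * (inner_poly \<beta> + const2 (1 / 2))) *
        shift2 (of_int m) (snd v))"
  "Psi_basis_action lam \<beta> (Q k) v =
     (const2 (lam powi (k + 1)) * inner_poly [:0, 1:] * shift2 (half k) (snd v), 0)"
  "Psi_basis_action lam \<beta> C1 v = 0" "Psi_basis_action lam \<beta> C3 v = 0"
  by (cases v; simp)+

lemma Psi_basis_action_add:
  "Psi_basis_action lam \<beta> i (v + w) = Psi_basis_action lam \<beta> i v + Psi_basis_action lam \<beta> i w"
  by (cases i) (auto simp: shift2_simps algebra_simps prod_eq_iff)

lemma Psi_basis_action_scale: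
  "Psi_basis_action lam \<beta> i (Psi_scale c v) = Psi_scale c (Psi_basis_action lam \<beta> i v)"
  by (cases i) (auto simp: shift2_simps algebra_simps prod_eq_iff)

lemma const2_powi_add:
  "lam \<noteq> 0 \<Longrightarrow> const2 (lam powi (m + n)) = const2 (lam powi m) * const2 (lam powi n)"
  by (simp add: power_int_add const2_simps)

lemma const2_half: "const2 (of_int m / 2) = of_int m * const2 (1 / 2)"
  using const2_simps(4)[of "of_int m" "1 / 2"] by (simp add: const2_simps)

text \<open>
  The operators by which \<open>L\<^sub>m\<close> and \<open>Q\<^sub>p\<close> act on a single component. Here \<open>B\<close> is \<open>\<beta>\<close> on the even
  part and \<open>\<beta> + 1/2\<close> on the odd part, so that one commutator computation serves for both.
\<close>

definition L_op :: "complex \<Rightarrow> poly2 \<Rightarrow> int \<Rightarrow> poly2 \<Rightarrow> poly2"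
  where "L_op lam B m f = const2 (lam powi m) * (outer_var + of_int m * B) * shift2 (of_int m) f"

definition Q_op :: "complex \<Rightarrow> int \<Rightarrow> poly2 \<Rightarrow> poly2"
  where "Q_op lam k h = const2 (lam powi (k + 1)) * inner_poly [:0, 1:] * shift2 (half k) h"

lemma Psi_basis_action_eq:
  "Psi_basis_action lam \<beta> (L m) v =
    (L_op lam (inner_poly \<beta>) m (fst v), L_op lam (inner_poly \<beta> + const2 (1 / 2)) m (snd v))"
  "Psi_basis_action lam \<beta> (Q k) v = (Q_op lam k (snd v), 0)"
  by (simp_all add: L_op_def Q_op_def)

text \<open>
  The commutators after all shifts have been carried out; what is left holds in any commutative ring.
\<close>

lemma L_ring_identity:
  fixes u v x y p q f :: "'a::comm_ring_1"
  shows "(u - v) * (p * q * (x + (u + v) * y) * f) =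
    p * (x + u * y) * (q * (x + u + v * y) * f) - q * (x + v * y) * (p * (x + v + u * y) * f)"
  by (simp add: algebra_simps)

lemma LQ_ring_identity:
  fixes u w x y z h p q f :: "'a::comm_ring_1"
  shows "- (u * h + w) * (p * q * z * f) =
    p * (x + u * y) * (q * z * f) - q * z * (p * (x + w + u * (y + h)) * f)"
  by (simp add: algebra_simps)

lemma L_op_commutator:
  assumes "lam \<noteq> 0" and B: "\<And>c. shift2 c B = B"
  shows "(of_int m - of_int n) * L_op lam B (m + n) f =
    L_op lam B m (L_op lam B n f) - L_op lam B n (L_op lam B m f)"
proof -
  have "shift2 (of_int n) (shift2 (of_int m) f) = shift2 (of_int (m + n)) f"
    "shift2 (of_int m) (shift2 (of_int n) f) = shift2 (of_int (m + n)) f"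
    by (simp_all add: shift2_shift2 add.commute)
  then show ?thesis
    unfolding L_op_def shift2_simps B const2_simps(7) of_int_add[where 'a = poly2]
      const2_powi_add[OF assms(1)]
    by (simp only: L_ring_identity)
qed

text \<open>
  The summand \<open>1/2\<close> by which the two components differ produces the term \<open>m/2\<close> of
  \<open>[L\<^sub>m, Q\<^sub>p] = - (m/2 + p) Q\<^bsub>m+p\<^esub>\<close>, and the term \<open>p\<close> comes from the shift of the outer variable by \<open>Q\<^sub>p\<close>.
\<close>

lemma L_Q_op_commutator:
  assumes "lam \<noteq> 0" and B: "\<And>c. shift2 c B = B"
  shows "const2 (- (of_int m / 2 + half k)) * Q_op lam (m + k) h =
    L_op lam B m (Q_op lam k h) - Q_op lam k (L_op lam (B + const2 (1 / 2)) m h)"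
proof -
  have "shift2 (half k) (shift2 (of_int m) h) = shift2 (half (m + k)) h"
    "shift2 (of_int m) (shift2 (half k) h) = shift2 (half (m + k)) h"
    by (simp_all add: shift2_shift2 half_add(1)[of m k] add.commute[of "half k"])
  then show ?thesis
    unfolding L_op_def Q_op_def shift2_simps B const2_simps(3,5) const2_half add.assoc[of m k 1]
      const2_powi_add[OF assms(1), of m]
    by (simp only: LQ_ring_identity)
qed

lemma L_Q_op_zero:
  "L_op lam B m 0 = 0" "Q_op lam k 0 = 0"
  by (simp_all add: L_op_def Q_op_def shift2_simps)

lemma Psi_basis_commutator:
  assumes lam: "lam \<noteq> 0"
  shows "linext Psi_scale (\<lambda>i. Psi_basis_action lam \<beta> i v) (fv_basis_bracket i j) =
    Psi_basis_action lam \<beta> i (Psi_basis_action lam \<beta> j v) -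
    Psi_scale (super_sign (fv_parity i) (fv_parity j))
      (Psi_basis_action lam \<beta> j (Psi_basis_action lam \<beta> i v))"
proof -
  define B where "B = inner_poly \<beta>"
  have B: "shift2 c B = B" "shift2 c (B + const2 (1 / 2)) = B + const2 (1 / 2)" for c
    by (simp_all add: B_def shift2_simps)
  note LL = L_op_commutator[OF lam B(1)] L_op_commutator[OF lam B(2)]
  note LQ = L_Q_op_commutator[OF lam B(1)]
  have const2_int: "const2 (of_int (m - n)) = of_int m - of_int n" for m n
    by (simp add: const2_simps)
  have sgn: "super_sign 0 a = 1" "super_sign a 0 = 1" for a by (simp_all add: super_sign_def)
  note defs = Psi_basis_action_eq Psi_basis_action_apply(3,4) B_def[symmetric] fst_conv snd_conv
    fv_parity.simps sgn psi.scale_one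
  show ?thesis
  proof (cases i; cases j)
    fix m n assume ij: "i = L m" "j = L n"
    show ?thesis
      unfolding ij fv_basis_bracket_LL psi.linext_add psi.linext_single defs
      by (intro prod_eqI) (simp_all only: LL fst_add snd_add fst_diff snd_diff Psi_scale_components
          psi.scale_zero_right const2_int add_0_right fst_conv snd_conv)
  next
    fix m k assume ij: "i = L m" "j = Q k"
    show ?thesis
      unfolding ij fv_basis_bracket.simps psi.linext_single defs
      by (intro prod_eqI) (simp_all only: LQ fst_diff snd_diff Psi_scale_components
          fst_conv snd_conv L_Q_op_zero mult_zero_right diff_self)
  next
    fix k m assume ij: "i = Q k" "j = L m"
    have "const2 (of_int m / 2 + half k) * Q_op lam (m + k) h =
        Q_op lam k (L_op lam (B + const2 (1 / 2)) m h) - L_op lam B m (Q_op lam k h)" for h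
      using arg_cong[OF LQ[of m k h], of uminus]
      by (simp only: const2_simps(5) mult_minus_left minus_minus minus_diff_eq)
    then show ?thesis
      unfolding ij fv_basis_bracket.simps psi.linext_single defs
      by (intro prod_eqI) (simp_all only: fst_diff snd_diff Psi_scale_components
          fst_conv snd_conv L_Q_op_zero mult_zero_right diff_self)
  next
    fix k l assume ij: "i = Q k" "j = Q l"
    show ?thesis
      unfolding ij fv_basis_bracket_QQ psi.linext_single defs
      by (simp add: L_Q_op_zero zero_prod_def[symmetric] prod_eq_iff)
  qed (simp_all add: prod_eq_iff L_Q_op_zero Psi_basis_action_eq shift2_simps)
qed

lemma Psi_action_simps:
  "action (Psi lam \<beta>) u (v + w) = action (Psi lam \<beta>) u v + action (Psi lam \<beta>) u w"
  "action (Psi lam \<beta>) u (Psi_scale c v) = Psi_scale c (action (Psi lam \<beta>) u v)"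
  by (simp_all add: Psi_basis_action_add Psi_basis_action_scale psi.linext_add_fun psi.linext_scale_fun)

lemma Psi_basis_action_grade:
  "v \<in> pair_grade b \<Longrightarrow> Psi_basis_action lam \<beta> i v \<in> pair_grade (fv_parity i + b)"
  by (cases i; cases b) (auto simp: pair_grade_def shift2_simps zero_prod_def)

lemma pair_grade_closed:
  "0 \<in> pair_grade a" "v \<in> pair_grade a \<Longrightarrow> w \<in> pair_grade a \<Longrightarrow> v + w \<in> pair_grade a"
  "v \<in> pair_grade a \<Longrightarrow> Psi_scale c v \<in> pair_grade a"
  by (auto simp: pair_grade_def Psi_scale_def zero_prod_def split: if_splits)

lemma pair_grade_decompose:
  "\<exists>x\<in>pair_grade 0. \<exists>y\<in>pair_grade 1. (v :: 'b::monoid_add \<times> 'b) = x + y"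
  by (intro bexI[of _ "(fst v, 0)"] bexI[of _ "(0, snd v)"]) (auto simp: pair_grade_def prod_eq_iff)

lemma super_vector_space_Psi: "super_vector_space (Psi lam \<beta>)"
proof (intro super_vector_space.intro super_vector_space_axioms.intro)
  show mod: "module complex_ring (Psi lam \<beta>)"
    by (rule complex_module_of_vector_space) (simp_all add: vector_space_Psi_scale)
  show "submodule (grade (Psi lam \<beta>) a) complex_ring (Psi lam \<beta>)" for a
    by (rule complex_submoduleI[OF mod]) (simp_all add: pair_grade_closed)
  show "grade (Psi lam \<beta>) 0 \<inter> grade (Psi lam \<beta>) 1 = {\<zero>\<^bsub>Psi lam \<beta>\<^esub>}"
    by (auto simp: pair_grade_def zero_prod_def)
  show "grade (Psi lam \<beta>) 0 <+>\<^bsub>Psi lam \<beta>\<^esub> grade (Psi lam \<beta>) 1 = carrier (Psi lam \<beta>)"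
    using pair_grade_decompose by (auto simp: set_add_def')
qed

lemma lie_supermodule_Psi:
  assumes lam: "lam \<noteq> 0"
  shows "lie_supermodule fv_algebra (Psi lam \<beta>)"
proof (intro lie_supermodule.intro lie_supermodule_axioms.intro
    lie_superalgebra_fv super_vector_space_Psi)
  let ?A = "action (Psi lam \<beta>)"
  have mod: "module complex_ring (Psi lam \<beta>)"
    using super_vector_space_Psi by (simp add: super_vector_space_def)
  show "bilinear_map fv_algebra (Psi lam \<beta>) (Psi lam \<beta>) ?A"
    unfolding bilinear_map_def using Psi_action_simps[of lam \<beta>]
    by (simp add: psi.linext_add psi.linext_scale)
  have add: "?A (x + y) v = ?A x v + ?A y v" "?A (fv_scale c x) v = Psi_scale c (?A x v)"
    "?A 0 v = 0" "?A x 0 = 0" for x y c v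
    using Psi_action_simps(2)[of lam \<beta> x 0 0] by (simp_all add: psi.linext_add psi.linext_scale)
  fix x a assume "x \<in> grade fv_algebra a"
  then have x: "x \<in> fv_grade a" by simp
  show "?A x v \<in> grade (Psi lam \<beta>) (a + b)" if "v \<in> grade (Psi lam \<beta>) b" for v b
    using x
  proof (induction x rule: fv_grade_induct)
    case (single i c)
    then show ?case
      using that Psi_basis_action_grade[of v b lam \<beta> i] by (auto intro: pair_grade_closed(3))
  qed (use pair_grade_closed in \<open>auto simp: psi.linext_add\<close>)
  fix y b v assume "y \<in> grade fv_algebra b"
  then have y: "y \<in> fv_grade b" by simp
  have "?A (fv_bracket x y) v = ?A x (?A y v) - Psi_scale (super_sign a b) (?A y (?A x v))"
    using x
  proof (induction x rule: fv_grade_induct)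
    case (single i c)
    from y show ?case
    proof (induction y rule: fv_grade_induct)
      case (single j d)
      have A1: "?A (Poly_Mapping.single i 1) v = Psi_basis_action lam \<beta> i v" for i v by simp
      have "?A (fv_bracket (Poly_Mapping.single i 1) (Poly_Mapping.single j 1)) v =
          ?A (Poly_Mapping.single i 1) (?A (Poly_Mapping.single j 1) v) -
          Psi_scale (super_sign a b) (?A (Poly_Mapping.single j 1) (?A (Poly_Mapping.single i 1) v))"
        using Psi_basis_commutator[OF lam, of \<beta> v i j] \<open>fv_parity i = a\<close> \<open>fv_parity j = b\<close>
        unfolding A1 by simp
      then show ?case
        by (simp only: fv_bracket_simps add Psi_action_simps psi.scale_right_diff_distrib
            psi.scale_scale mult_ac)
    qed (simp_all only: fv_bracket_simps add Psi_action_simps psi.scale_right_distrib psi.scale_zero_right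
          add_diff_add diff_self)
  qed (simp_all only: fv_bracket_simps add Psi_action_simps psi.scale_right_distrib psi.scale_zero_right
          add_diff_add diff_self)
  then show "?A (bracket fv_algebra x y) v =
      ?A x (?A y v) \<ominus>\<^bsub>Psi lam \<beta>\<^esub> super_sign a b \<odot>\<^bsub>Psi lam \<beta>\<^esub> ?A y (?A x v)"
    using complex_module_minus[OF mod]
    by (simp del: Psi_simps(6) add: psi.scale_minus_left)
qed

section \<open>Specialising the inner variable\<close>

definition ev :: "complex \<Rightarrow> poly2 \<Rightarrow> complex poly"
  where "ev b = map_poly (\<lambda>p. poly p b)"

lemma coeff_ev [simp]: "coeff (ev b f) n = poly (coeff f n) b"
  by (simp add: ev_def coeff_map_poly)

lemma ev_pCons: "ev b (pCons p f) = pCons (poly p b) (ev b f)"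
  by (simp add: ev_def map_poly_pCons)

lemma ev_simps [simp]:
  "ev b 0 = 0" "ev b (f + h) = ev b f + ev b h" "ev b (f * h) = ev b f * ev b h"
  "ev b outer_var = [:0, 1:]" "ev b (inner_poly g) = [:poly g b:]" "ev b (const2 c) = [:c:]"
  "ev b (of_int m) = of_int m"
  by (auto intro!: poly_eqI simp: coeff_mult poly_sum outer_var_def inner_poly_def const2_def
      of_int_poly ev_pCons coeff_pCons split: nat.split)

lemma shift1_pCons: "shift1 c (pCons a p) = [:a:] + [:c, 1:] * shift1 c p"
  by (simp add: shift1_def pcompose_pCons)

lemma shift2_pCons: "shift2 c (pCons a f) = inner_poly a + (outer_var + const2 c) * shift2 c f"
  by (simp add: shift2_def pcompose_pCons inner_poly_def)

lemma ev_shift2 [simp]: "ev b (shift2 c f) = shift1 c (ev b f)"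
proof (induction f)
  case 0
  show ?case by (simp add: shift1_def shift2_def)
next
  case (pCons p f)
  then show ?case by (simp add: shift2_pCons shift1_pCons ev_pCons)
qed

lemma ev_surj: "ev b (map_poly (\<lambda>c. [:c:]) p) = p"
  by (rule poly_eqI) (simp add: coeff_map_poly)

text \<open>
  The factor theorem, applied to each coefficient.
\<close>

lemma ev_eq_0_iff: "ev b f = 0 \<longleftrightarrow> (\<exists>h. f = inner_poly [:- b, 1:] * h)"
proof -
  have "ev b f = 0 \<longleftrightarrow> (\<forall>n. [:- b, 1:] dvd coeff f n)"
    by (simp add: poly_eq_iff poly_eq_0_iff_dvd)
  also have "\<dots> \<longleftrightarrow> inner_poly [:- b, 1:] dvd f"
    by (simp add: inner_poly_def const_poly_dvd_iff)
  finally show ?thesis by (simp add: dvd_def)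
qed

lemma inner_poly_mult: "inner_poly (g * h) = inner_poly g * inner_poly h"
  by (simp add: inner_poly_def)

section \<open>The module \<open>\<Phi>\<close> as a specialisation of \<open>\<Psi>\<close>\<close>

lemma Phi_simps [simp]:
  "carrier (Phi lam \<beta> b) = UNIV" "\<zero>\<^bsub>Phi lam \<beta> b\<^esub> = 0" "add (Phi lam \<beta> b) = (+)"
  "module.smult (Phi lam \<beta> b) = Phi_scale" "grade (Phi lam \<beta> b) = pair_grade"
  "action (Phi lam \<beta> b) u v = linext Phi_scale (\<lambda>i. Phi_basis_action lam \<beta> b i v) u"
  by (simp_all add: Phi_def pair_grade_def fun_eq_iff linext_def fv_linear_extension_def)

definition ev_pair :: "complex \<Rightarrow> poly2 \<times> poly2 \<Rightarrow> complex poly \<times> complex poly"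
  where "ev_pair b = map_prod (ev b) (ev b)"

lemma ev_pair_simps:
  "ev_pair b 0 = 0" "ev_pair b (v + w) = ev_pair b v + ev_pair b w"
  "ev_pair b (Psi_scale c v) = Phi_scale c (ev_pair b v)"
  by (simp_all add: ev_pair_def prod_eq_iff Phi_scale_def)

lemma ev_L_op:
  "ev b (L_op lam B m f) =
    Polynomial.smult (lam powi m) (([:0, 1:] + of_int m * ev b B) * shift1 (of_int m) (ev b f))"
  by (simp add: L_op_def)

lemma ev_Q_op:
  "ev b (Q_op lam k h) = Polynomial.smult (lam powi (k + 1) * b) (shift1 (half k) (ev b h))"
  by (simp add: Q_op_def mult.commute)

lemma ev_pair_basis_action:
  "ev_pair b (Psi_basis_action lam \<beta> i v) = Phi_basis_action lam \<beta> b i (ev_pair b v)"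
proof (cases i)
  case (L m)
  have "[:0, 1:] + of_int m * [:c:] = [:of_int m * c, 1::complex:]" for c
    by (simp add: of_int_poly)
  then show ?thesis
    by (simp add: L ev_pair_def Psi_basis_action_eq map_prod_def split_beta ev_L_op
        del: Psi_basis_action_apply)
next
  case (Q k)
  then show ?thesis
    by (simp add: ev_pair_def Psi_basis_action_eq map_prod_def split_beta ev_Q_op
        del: Psi_basis_action_apply)
qed (simp_all add: ev_pair_def map_prod_def split_beta zero_prod_def)

lemma ev_pair_action: "ev_pair b (action (Psi lam \<beta>) u v) = action (Phi lam \<beta> b) u (ev_pair b v)"
proof -
  have "ev_pair b (\<Sum>i\<in>I. F i) = (\<Sum>i\<in>I. ev_pair b (F i))" for I and F :: "fv_basis \<Rightarrow> poly2 \<times> poly2"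
    by (induction I rule: infinite_finite_induct) (simp_all add: ev_pair_simps)
  then show ?thesis
    by (simp add: linext_def ev_pair_simps(3) ev_pair_basis_action)
qed

lemma ev_pair_grade: "ev_pair b ` pair_grade a = pair_grade a"
proof
  show "ev_pair b ` pair_grade a \<subseteq> pair_grade a"
    by (auto simp: ev_pair_def pair_grade_def)
  have "(p, 0) \<in> ev_pair b ` {(f, 0) |f. True}" for p
    using ev_surj[of b p]
    by (intro image_eqI[of _ _ "(map_poly (\<lambda>c. [:c:]) p, 0)"]) (simp_all add: ev_pair_def)
  moreover have "(0, p) \<in> ev_pair b ` {(0, h) |h. True}" for p
    using ev_surj[of b p]
    by (intro image_eqI[of _ _ "(0, map_poly (\<lambda>c. [:c:]) p)"]) (simp_all add: ev_pair_def)
  ultimately show "pair_grade a \<subseteq> ev_pair b ` pair_grade a"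
    by (auto simp: pair_grade_def)
qed

lemma ev_pair_surj: "surj (ev_pair b)"
  unfolding ev_pair_def by (intro map_prod_surj surjI[of _ "map_poly (\<lambda>c. [:c:])"] ev_surj)

text \<open>
  The relations are inherited from \<open>\<Psi>\<close> through specialisation, which is onto.
\<close>

lemma lie_supermodule_Phi:
  assumes lam: "lam \<noteq> 0"
  shows "lie_supermodule fv_algebra (Phi lam \<beta> b)"
proof (rule lie_supermodule_image[where h = "ev_pair b", OF lie_supermodule_Psi[OF lam]])
  show "ev_pair b (action (Psi lam \<beta>) x v) = action (Phi lam \<beta> b) x (ev_pair b v)" for x v
    by (rule ev_pair_action)
qed (simp_all add: ev_pair_simps ev_pair_grade ev_pair_surj, auto simp: pair_grade_def zero_prod_def)

section \<open>The submodules \<open>M_fv g\<close> and their quotients\<close>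

definition inner_mult :: "complex poly \<Rightarrow> poly2 \<times> poly2 \<Rightarrow> poly2 \<times> poly2"
  where "inner_mult g v = (inner_poly g * fst v, inner_poly g * snd v)"

lemma M_fv_eq: "M_fv g = range (inner_mult g)"
  unfolding M_fv_def inner_mult_def by (force intro: range_eqI[of _ _ "(f, h)" for f h])

lemma inner_mult_simps:
  "inner_mult g 0 = 0" "inner_mult g (v + w) = inner_mult g v + inner_mult g w"
  "inner_mult g (Psi_scale c v) = Psi_scale c (inner_mult g v)"
  "inner_mult (g * h) v = inner_mult g (inner_mult h v)" "inner_mult 1 v = v"
  by (simp_all add: inner_mult_def prod_eq_iff algebra_simps inner_poly_mult)
     (simp add: inner_poly_def flip: one_pCons)

lemma inner_mult_basis_action:
  "Psi_basis_action lam \<beta> i (inner_mult g v) = inner_mult g (Psi_basis_action lam \<beta> i v)"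
  by (cases i) (simp_all add: inner_mult_def shift2_simps prod_eq_iff ac_simps)

text \<open>
  The inner variable is fixed by all shifts, and \<open>Q\<^sub>p\<close> sends \<open>t\<close> to \<open>y\<close>; so the factors \<open>g(t)\<close> and \<open>g(y)\<close>
  pass through the action.
\<close>

lemma inner_mult_action:
  "action (Psi lam \<beta>) u (inner_mult g v) = inner_mult g (action (Psi lam \<beta>) u v)"
proof -
  have "inner_mult g (\<Sum>i\<in>I. F i) = (\<Sum>i\<in>I. inner_mult g (F i))" for I and F :: "fv_basis \<Rightarrow> poly2 \<times> poly2"
    by (induction I rule: infinite_finite_induct) (simp_all add: inner_mult_simps)
  then show ?thesis
    by (simp add: linext_def inner_mult_basis_action inner_mult_simps(3))
qed

lemma inner_mult_grade: "v \<in> pair_grade a \<Longrightarrow> inner_mult g v \<in> pair_grade a"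
  by (auto simp: pair_grade_def inner_mult_def split: if_splits)

lemma lie_subsupermodule_M_fv:
  assumes lam: "lam \<noteq> 0"
  shows "lie_subsupermodule (M_fv g) fv_algebra (Psi lam \<beta>)"
proof (intro lie_subsupermodule.intro lie_subsupermodule_axioms.intro lie_supermodule_Psi[OF lam])
  have mod: "module complex_ring (Psi lam \<beta>)"
    by (rule lie_supermodule_module[OF lie_supermodule_Psi[OF lam]])
  show "submodule (M_fv g) complex_ring (Psi lam \<beta>)"
    by (rule complex_submoduleI[OF mod])
      (auto simp: M_fv_eq simp flip: inner_mult_simps(2,3)
        intro: range_eqI[of _ _ 0] inner_mult_simps(1)[symmetric])
  show "action (Psi lam \<beta>) x v \<in> M_fv g" if "v \<in> M_fv g" for x v
    using that by (auto simp: M_fv_eq inner_mult_action simp del: Psi_simps(6))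
  show "M_fv g = (M_fv g \<inter> grade (Psi lam \<beta>) 0) <+>\<^bsub>Psi lam \<beta>\<^esub> (M_fv g \<inter> grade (Psi lam \<beta>) 1)"
  proof
    show "M_fv g \<subseteq> (M_fv g \<inter> grade (Psi lam \<beta>) 0) <+>\<^bsub>Psi lam \<beta>\<^esub> (M_fv g \<inter> grade (Psi lam \<beta>) 1)"
    proof
      fix v assume "v \<in> M_fv g"
      then obtain w where v: "v = inner_mult g w" by (auto simp: M_fv_eq)
      obtain x y where "x \<in> pair_grade 0" "y \<in> pair_grade 1" "w = x + y"
        using pair_grade_decompose[of w] by blast
      then show "v \<in> (M_fv g \<inter> grade (Psi lam \<beta>) 0) <+>\<^bsub>Psi lam \<beta>\<^esub> (M_fv g \<inter> grade (Psi lam \<beta>) 1)"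
        unfolding v by (auto simp: set_add_def' M_fv_eq inner_mult_simps intro!: inner_mult_grade)
    qed
    show "(M_fv g \<inter> grade (Psi lam \<beta>) 0) <+>\<^bsub>Psi lam \<beta>\<^esub> (M_fv g \<inter> grade (Psi lam \<beta>) 1) \<subseteq> M_fv g"
      by (auto simp: set_add_def' M_fv_eq simp flip: inner_mult_simps(2))
  qed
qed

lemma M_fv_mult_subset: "M_fv (g * h) \<subseteq> M_fv g"
  by (auto simp: M_fv_eq inner_mult_simps)

lemma M_fv_1: "M_fv 1 = UNIV"
  by (auto simp: M_fv_eq inner_mult_simps)

text \<open>
  Multiplication by \<open>g'\<close> identifies \<open>\<Psi>\<close> with \<open>M_fv g'\<close>, and the multiples of \<open>y - b\<close> with the
  multiples of \<open>(y - b) g'\<close>. So the quotient is that of \<open>\<Psi>\<close> by the kernel of specialisation at \<open>b\<close>.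
\<close>

lemma M_fv_quotient_isomorphic:
  assumes lam: "lam \<noteq> 0" and g': "g' \<noteq> 0"
  shows "supermod_isomorphic fv_algebra
    (quotient_supermod (restrict_supermod (Psi lam \<beta>) (M_fv g')) (M_fv ([:- b, 1:] * g')))
    (Phi lam \<beta> b)"
proof -
  let ?V = "restrict_supermod (Psi lam \<beta>) (M_fv g')"
  \<comment> \<open>On \<open>M_fv g'\<close> the division is exact.\<close>
  define \<phi> where "\<phi> v = ev_pair b (fst v div inner_poly g', snd v div inner_poly g')" for v
  have [simp]: "inner_poly g' \<noteq> 0" using g' by (simp add: inner_poly_def)
  have \<phi>: "\<phi> (inner_mult g' v) = ev_pair b v" for v
    by (simp add: \<phi>_def inner_mult_def)
  have V [simp]: "carrier ?V = range (inner_mult g')" "add ?V = (+)" "module.smult ?V = Psi_scale"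
      "action ?V = action (Psi lam \<beta>)" "grade ?V a = range (inner_mult g') \<inter> pair_grade a" for a
    by (simp_all add: restrict_supermod_def M_fv_eq)
  have inj: "inner_mult g' v \<in> pair_grade a \<longleftrightarrow> v \<in> pair_grade a" for v a
    by (auto simp: inner_mult_def pair_grade_def prod_eq_iff split: if_splits)
  have hom: "\<phi> \<in> supermod_hom fv_algebra ?V (Phi lam \<beta> b)"
    unfolding supermod_hom_def V mem_Collect_eq
    using equalityD1[OF ev_pair_grade[of b], THEN subsetD, OF imageI]
    by (auto simp: \<phi> inj inner_mult_action ev_pair_action ev_pair_simps
        simp del: Psi_simps(6) Phi_simps(6) simp flip: inner_mult_simps(2,3))
  have onto: "\<phi> ` carrier ?V = carrier (Phi lam \<beta> b)"
    using ev_pair_surj[of b] by (simp add: image_image \<phi>)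
  have "ev_pair b v = 0 \<longleftrightarrow> v \<in> M_fv [:- b, 1:]" for v
    by (cases v) (auto simp: ev_pair_def M_fv_def prod_eq_iff ev_eq_0_iff)
  then have "{v \<in> carrier ?V. \<phi> v = \<zero>\<^bsub>Phi lam \<beta> b\<^esub>} = inner_mult g' ` M_fv [:- b, 1:]"
    by (auto simp: \<phi>)
  also have "\<dots> = M_fv ([:- b, 1:] * g')"
    by (simp only: M_fv_eq mult.commute[of "[:- b, 1:]"] image_image flip: inner_mult_simps(4))
  finally have ker: "{v \<in> carrier ?V. \<phi> v = \<zero>\<^bsub>Phi lam \<beta> b\<^esub>} = M_fv ([:- b, 1:] * g')" .
  show ?thesis
    using quotient_supermod_kernel_isomorphic[OF
        lie_supermodule_restrict[OF lie_subsupermodule_M_fv[OF lam]] lie_supermodule_Phi[OF lam] hom onto]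
    unfolding ker .
qed

theorem proposition5p11:
  fixes lam :: complex and \<beta> :: "complex poly"
  assumes lam: "lam \<noteq> 0"
  shows "(\<forall>\<alpha>::complex.
            (\<forall>n. lie_subsupermodule (M_fv ([:- \<alpha>, 1:] ^ n)) fv_algebra (Psi lam \<beta>)) \<and>
            (\<forall>n. M_fv ([:- \<alpha>, 1:] ^ Suc n) \<subseteq> M_fv ([:- \<alpha>, 1:] ^ n)) \<and>
            M_fv ([:- \<alpha>, 1:] ^ 0) = carrier (Psi lam \<beta>)) \<and>
         (\<forall>(b::complex) (g::complex poly) (g'::complex poly).
            g \<noteq> 0 \<longrightarrow> g = [:- b, 1:] * g' \<longrightarrow>
            supermod_isomorphic fv_algebra
              (quotient_supermod (restrict_supermod (Psi lam \<beta>) (M_fv g')) (M_fv g))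
              (Phi lam \<beta> b))"
proof (intro conjI allI impI)
  fix \<alpha> :: complex and n :: nat
  show "lie_subsupermodule (M_fv ([:- \<alpha>, 1:] ^ n)) fv_algebra (Psi lam \<beta>)"
    by (rule lie_subsupermodule_M_fv[OF lam])
  show "M_fv ([:- \<alpha>, 1:] ^ Suc n) \<subseteq> M_fv ([:- \<alpha>, 1:] ^ n)"
    unfolding power_Suc2 by (rule M_fv_mult_subset)
  show "M_fv ([:- \<alpha>, 1:] ^ 0) = carrier (Psi lam \<beta>)"
    by (simp add: M_fv_1)
next
  fix b :: complex and g g' :: "complex poly"
  assume "g \<noteq> 0" and g: "g = [:- b, 1:] * g'"
  then have "g' \<noteq> 0" by auto
  then show "supermod_isomorphic fv_algebra
      (quotient_supermod (restrict_supermod (Psi lam \<beta>) (M_fv g')) (M_fv g)) (Phi lam \<beta> b)"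
    unfolding g by (rule M_fv_quotient_isomorphic[OF lam])
qed

end
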